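(* Let $K$ and $K'$ be oriented twisted knot diagrams such that $K'$ is obtained from $K$ by a single oriented Reidemeister move of any of the types $C_1,C_2,C_3$ (classical), $V_1,V_2,V_3,V_4$ (virtual), $T_1,T_2,T_3$ (twisted), with any orientation of the strands involved. Then $Q^{z}_{K}(s,t)=Q^{z}_{K'}(s,t)$. That is, the polynomial $Q^{z}_{K}(s,t)\in\mathbb{Z}[s,t]$ is invariant under all classical, virtual and twisted Reidemeister moves.
   Context: Twisted knot diagrams. An oriented twisted knot diagram $K$ is a generic immersed oriented closed curve in $\mathbb{R}^2$ with finitely many transverse double points, each marked either as a classical crossing (with over/under information) or as a virtual crossing (no over/under information), together with finitely many bars (short transverse marks) on the curve away from the double points. Diagrams are considered up to planar isotopy. $C(K)$ is the set of classical crossings and $sgn(c)=sign(c)\in\{+1,-1\}$ is the usual sign of $c\in C(K)$. Reidemeister moves. $C_1,C_2,C_3$ are the usual classical Reidemeister moves; $V_1,V_2,V_3$ are the same moves with all crossings virtual; $V_4$ moves an arc having two consecutive virtual crossings across a classical crossing. $T_1$ inserts or deletes two adjacent bars on an arc. $T_2$ slides a bar along its strand through a virtual crossing. $T_3$ replaces a classical crossing $c$ having a bar on each of its four adjacent arcs (one before and one after $c$ on each strand) by a bar-free tangle with the same end points and the same connectivity in which the two strands cross first virtually, then at one classical crossing $c'$, then again virtually; the strand that is over at $c$ is under at $c'$, and $sgn(c')=sgn(c)$. All orientations are allowed. Smoothing. For $c\in C(K)$, let $K_c$ be the two-component diagram obtained by the oriented smoothing at $c$, its components labelled $0$ and $1$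 (which component gets which label does not affect the definitions of $ZC(K)$, $z$ and $Q^z$). Affine index. For $l\in\{0,1\}$, traverse the $l$-component of $K_c$ once along its orientation starting near $c$, and let $\gamma_1,\dots,\gamma_{k_l}$ be the sequence of classical crossings met (with repetition). Put $\epsilon_i=0$ if the traversal passes under at $\gamma_i$ and $\epsilon_i=1$ if it passes over. Then $ind^{\,l}(c,K)=\sum_{i=1}^{k_l}(-1)^{\epsilon_i}sign(\gamma_i)$. (Self-crossings of the $l$-component contribute zero, and $ind^{\,1}(c,K)=-ind^{\,0}(c,K)$.) Zero crossings. $c\in C(K)$ is a zero crossing if $ind^{\,l}(c,K)$ is even for $l=0$ or $1$ (equivalently both). $ZC(K)$ is the set of zero crossings. For $c\in ZC(K)$ the zero affine index is $zind^{\,l}(c,K)=\sum_{\gamma_i\in ZC(K)}(-1)^{\epsilon_i}sign(\gamma_i)$, the sum being over those terms of the sequence $\gamma_1,\dots,\gamma_{k_l}$ of classical crossings met along the $l$-component of $K_c$ that are zero crossings of $K$, and $z(c)\in\{0,1\}$ is the residue of $zind^{\,l}(c,K)$ mod $2$ (independent of $l$). Bar parity. For $c\in C(K)$, $p^l(c)\in\{0,1\}$ is the parity of the number of bars on the $l$-component of $K_c$. The polynomial. $$Q^{z}_{K}(s,t)=\sum_{c\in ZC(K)}sgn(c)\bigl(s^{z(c)}t^{p^{0}(c)}-1\bigr)\bigl(s^{z(c)}t^{p^{1}(c)}-1\bigr)+\sum_{c\in C(K)\setminus ZC(K)}sgn(c)\bigl(s\,t^{p^{0}(c)}-1\bigr)\bigl(s\,t^{p^{1}(c)}-1\bigr).$$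 *)

theory Defs
  imports "HOL-Analysis.Analysis" "HOL-Computational_Algebra.Polynomial"
begin

section \<open>Oriented twisted knot diagrams\<close>

text \<open>
  The plane is the type complex. A closed curve is given by a 1-periodic parametrisation; its
  orientation is the direction of increasing parameter. Passages of the curve through double
  points, and bars, are recorded by their parameters in [0,1).
\<close>

record diagram =
  curve :: "real \<Rightarrow> complex"
  virtuals :: "complex set"
  overs :: "real set"
  bars :: "real set"

definition velocity :: "diagram \<Rightarrow> real \<Rightarrow> complex" where
  "velocity K x = vector_derivative (curve K) (at x)"

text \<open>
  The determinant of two plane vectors \<open>u\<close>, \<open>v\<close> is \<open>Im (cnj u * v)\<close>. So \<open>turn K x y\<close> is 1 if the
  branch at parameter \<open>y\<close> crosses the branch at parameter \<open>x\<close> from right to left, and -1 if it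
  crosses from left to right.
\<close>

definition turn :: "diagram \<Rightarrow> real \<Rightarrow> real \<Rightarrow> int" where
  "turn K x y = (if Im (cnj (velocity K x) * velocity K y) > 0 then 1 else -1)"

definition double_points :: "diagram \<Rightarrow> complex set" where
  "double_points K = {c. \<exists>x\<in>{0..<1}. \<exists>y\<in>{0..<1}. x \<noteq> y \<and> curve K x = c \<and> curve K y = c}"

definition classical_crossings :: "diagram \<Rightarrow> complex set" where
  "classical_crossings K = double_points K - virtuals K"

definition generic_closed_curve :: "diagram \<Rightarrow> bool" where
  "generic_closed_curve K \<longleftrightarrow>
     (\<forall>x. curve K (x + 1) = curve K x) \<and>
     (\<forall>x. curve K differentiable (at x)) \<and>
     continuous_on UNIV (velocity K) \<and>
     (\<forall>x. velocity K x \<noteq> 0) \<and>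
     finite (double_points K) \<and>
     (\<forall>x\<in>{0..<1}. \<forall>y\<in>{0..<1}. \<forall>w\<in>{0..<1}.
        curve K x = curve K y \<and> curve K y = curve K w \<longrightarrow> x = y \<or> y = w \<or> x = w) \<and>
     (\<forall>x\<in>{0..<1}. \<forall>y\<in>{0..<1}.
        x \<noteq> y \<and> curve K x = curve K y \<longrightarrow> Im (cnj (velocity K x) * velocity K y) \<noteq> 0)"

definition twisted_knot_diagram :: "diagram \<Rightarrow> bool" where
  "twisted_knot_diagram K \<longleftrightarrow>
     generic_closed_curve K \<and>
     virtuals K \<subseteq> double_points K \<and>
     overs K \<subseteq> {x\<in>{0..<1}. curve K x \<in> classical_crossings K} \<and>
     (\<forall>x\<in>{0..<1}. \<forall>y\<in>{0..<1}.
        x \<noteq> y \<and> curve K x = curve K y \<and> curve K x \<in> classical_crossings K \<longrightarrow>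
        (x \<in> overs K \<longleftrightarrow> y \<notin> overs K)) \<and>
     bars K \<subseteq> {x\<in>{0..<1}. curve K x \<notin> double_points K} \<and>
     finite (bars K)"

definition over_param :: "diagram \<Rightarrow> complex \<Rightarrow> real" where
  "over_param K c = (THE x. x \<in> {0..<1} \<and> curve K x = c \<and> x \<in> overs K)"

definition under_param :: "diagram \<Rightarrow> complex \<Rightarrow> real" where
  "under_param K c = (THE x. x \<in> {0..<1} \<and> curve K x = c \<and> x \<notin> overs K)"

definition crossing_sign :: "diagram \<Rightarrow> complex \<Rightarrow> int" where
  "crossing_sign K c = turn K (over_param K c) (under_param K c)"


section \<open>The polynomial\<close>

text \<open>
  \<open>open_arc a b\<close> consists of the parameters in [0,1) met strictly after \<open>a\<close> and strictly before
  \<open>b\<close> when moving forward (modulo 1) from \<open>a\<close>. The oriented smoothing at \<open>c\<close> cuts the curve at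
  its two passages through \<open>c\<close>, and the two components of the smoothed diagram are the two
  resulting arcs. Component 0 is the one that leaves \<open>c\<close> along the over strand.
\<close>

definition open_arc :: "real \<Rightarrow> real \<Rightarrow> real set" where
  "open_arc a b = {x\<in>{0..<1}. 0 < frac (x - a) \<and> frac (x - a) < frac (b - a)}"

definition component :: "diagram \<Rightarrow> complex \<Rightarrow> nat \<Rightarrow> real set" where
  "component K c l =
     (if l = 0 then open_arc (over_param K c) (under_param K c)
      else open_arc (under_param K c) (over_param K c))"

definition eps :: "diagram \<Rightarrow> real \<Rightarrow> nat" where
  "eps K x = (if x \<in> overs K then 1 else 0)"

text \<open>
  The sequence of crossings met along a component is indexed by the parameters of its passages,
  so a self-crossing of the component is met twice.
\<close>

definition affine_index :: "diagram \<Rightarrow> complex \<Rightarrow> nat \<Rightarrow> int" where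
  "affine_index K c l =
     (\<Sum>x | x \<in> component K c l \<and> curve K x \<in> classical_crossings K.
        (-1) ^ eps K x * crossing_sign K (curve K x))"

definition zero_crossings :: "diagram \<Rightarrow> complex set" where
  "zero_crossings K =
     {c \<in> classical_crossings K. even (affine_index K c 0) \<or> even (affine_index K c 1)}"

definition zero_affine_index :: "diagram \<Rightarrow> complex \<Rightarrow> nat \<Rightarrow> int" where
  "zero_affine_index K c l =
     (\<Sum>x | x \<in> component K c l \<and> curve K x \<in> zero_crossings K.
        (-1) ^ eps K x * crossing_sign K (curve K x))"

definition z_parity :: "diagram \<Rightarrow> complex \<Rightarrow> nat" where
  "z_parity K c = nat (zero_affine_index K c 0 mod 2)"

definition bar_parity :: "diagram \<Rightarrow> complex \<Rightarrow> nat \<Rightarrow> nat" where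
  "bar_parity K c l = card (bars K \<inter> component K c l) mod 2"

text \<open>The ring \<open>\<int>[s,t]\<close> is represented as \<open>\<int>[s][t]\<close>.\<close>

definition s_var :: "int poly poly" where
  "s_var = [:[:0, 1:]:]"

definition t_var :: "int poly poly" where
  "t_var = [:0, 1:]"

definition Qz :: "diagram \<Rightarrow> int poly poly" where
  "Qz K =
     (\<Sum>c\<in>zero_crossings K.
        of_int (crossing_sign K c)
        * (s_var ^ z_parity K c * t_var ^ bar_parity K c 0 - 1)
        * (s_var ^ z_parity K c * t_var ^ bar_parity K c 1 - 1)) +
     (\<Sum>c\<in>classical_crossings K - zero_crossings K.
        of_int (crossing_sign K c)
        * (s_var * t_var ^ bar_parity K c 0 - 1)
        * (s_var * t_var ^ bar_parity K c 1 - 1))"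


section \<open>Planar isotopy\<close>

text \<open>An ambient isotopy of the plane through diffeomorphisms of class \<open>C\<^sup>1\<close>.\<close>

definition plane_isotopy :: "(real \<Rightarrow> complex \<Rightarrow> complex) \<Rightarrow> bool" where
  "plane_isotopy H \<longleftrightarrow>
     H 0 = id \<and>
     continuous_on ({0..1} \<times> UNIV) (\<lambda>(t, p). H t p) \<and>
     (\<forall>t\<in>{0..1}. bij (H t)) \<and>
     (\<exists>D :: real \<Rightarrow> complex \<Rightarrow> complex \<Rightarrow>\<^sub>L complex.
        (\<forall>t\<in>{0..1}. \<forall>p. (H t has_derivative blinfun_apply (D t p)) (at p)
                       \<and> bij (blinfun_apply (D t p))) \<and>
        continuous_on ({0..1} \<times> UNIV) (\<lambda>(t, p). D t p))"

text \<open>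
  A \<open>C\<^sup>1\<close> change of parameter of the oriented circle, lifted to the line; it may move the base
  point.
\<close>

definition reparametrization :: "(real \<Rightarrow> real) \<Rightarrow> bool" where
  "reparametrization \<phi> \<longleftrightarrow>
     (\<forall>x. \<phi> (x + 1) = \<phi> x + 1) \<and>
     (\<exists>\<phi>'. (\<forall>x. (\<phi> has_real_derivative \<phi>' x) (at x) \<and> \<phi>' x > 0) \<and> continuous_on UNIV \<phi>')"

definition planar_isotopic :: "diagram \<Rightarrow> diagram \<Rightarrow> bool" where
  "planar_isotopic K K' \<longleftrightarrow>
     (\<exists>H \<phi>. plane_isotopy H \<and> reparametrization \<phi> \<and>
        (\<forall>x. curve K' (\<phi> x) = H 1 (curve K x)) \<and>
        virtuals K' = H 1 ` virtuals K \<and>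
        overs K' = (\<lambda>x. frac (\<phi> x)) ` overs K \<and>
        bars K' = (\<lambda>x. frac (\<phi> x)) ` bars K)"


section \<open>Reidemeister moves\<close>

text \<open>
  A move replaces the part of the diagram inside a closed disc. The strands in the disc are given
  by the list of their parameter intervals \<open>(a, b)\<close>. The base point is assumed to lie outside the
  disc, which is no restriction since diagrams are considered up to reparametrisation.
\<close>

type_synonym strand = "real \<times> real"

definition interval :: "strand \<Rightarrow> real set" where
  "interval A = {fst A<..<snd A}"

definition inner :: "strand list \<Rightarrow> real set" where
  "inner As = (\<Union>A\<in>set As. interval A)"

definition ends :: "strand list \<Rightarrow> real set" where
  "ends As = (\<Union>A\<in>set As. {fst A, snd A})"

definition tangle_in_disc :: "complex set \<Rightarrow> strand list \<Rightarrow> diagram \<Rightarrow> bool" where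
  "tangle_in_disc D As K \<longleftrightarrow>
     D homeomorphic cball (0::complex) 1 \<and>
     (\<forall>A\<in>set As. 0 < fst A \<and> fst A < snd A \<and> snd A < 1) \<and>
     (\<forall>i<length As. \<forall>j<length As. i \<noteq> j \<longrightarrow>
        {fst (As ! i)..snd (As ! i)} \<inter> {fst (As ! j)..snd (As ! j)} = {}) \<and>
     (\<forall>x\<in>{0..<1}. curve K x \<in> interior D \<longleftrightarrow> x \<in> inner As) \<and>
     (\<forall>x\<in>{0..<1}. curve K x \<in> frontier D \<longleftrightarrow> x \<in> ends As) \<and>
     inj_on (curve K) (ends As)"

definition agree_outside :: "complex set \<Rightarrow> strand list \<Rightarrow> diagram \<Rightarrow> diagram \<Rightarrow> bool" where
  "agree_outside D As K K' \<longleftrightarrow>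
     (\<forall>x\<in>{0..<1} - inner As. curve K x = curve K' x) \<and>
     virtuals K - interior D = virtuals K' - interior D \<and>
     overs K - inner As = overs K' - inner As \<and>
     bars K - inner As = bars K' - inner As"

definition tangle_replacement ::
    "complex set \<Rightarrow> strand list \<Rightarrow> diagram \<Rightarrow> diagram \<Rightarrow> bool" where
  "tangle_replacement D As K K' \<longleftrightarrow>
     twisted_knot_diagram K \<and> twisted_knot_diagram K' \<and>
     tangle_in_disc D As K \<and> tangle_in_disc D As K' \<and> agree_outside D As K K'"

definition double_points_in :: "complex set \<Rightarrow> diagram \<Rightarrow> complex set" where
  "double_points_in D K = double_points K \<inter> interior D"

definition bars_in :: "strand list \<Rightarrow> diagram \<Rightarrow> real set" where
  "bars_in As K = bars K \<inter> inner As"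

definition cross_at :: "diagram \<Rightarrow> strand \<Rightarrow> strand \<Rightarrow> real \<Rightarrow> real \<Rightarrow> bool" where
  "cross_at K A B x y \<longleftrightarrow> x \<in> interval A \<and> y \<in> interval B \<and> curve K x = curve K y"

text \<open>Two arcs crossing exactly once.\<close>

definition single_crossing ::
    "complex set \<Rightarrow> diagram \<Rightarrow> strand \<Rightarrow> strand \<Rightarrow> real \<Rightarrow> real \<Rightarrow> bool" where
  "single_crossing D K A B x y \<longleftrightarrow>
     cross_at K A B x y \<and> double_points_in D K = {curve K x}"

text \<open>Two arcs crossing exactly twice, in opposite directions (a bigon).\<close>

definition bigon ::
    "complex set \<Rightarrow> diagram \<Rightarrow> strand \<Rightarrow> strand \<Rightarrow> real \<Rightarrow> real \<Rightarrow> real \<Rightarrow> real \<Rightarrow> bool" where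
  "bigon D K A B x1 y1 x2 y2 \<longleftrightarrow>
     x1 \<noteq> x2 \<and> cross_at K A B x1 y1 \<and> cross_at K A B x2 y2 \<and>
     double_points_in D K = {curve K x1, curve K x2} \<and>
     turn K x1 y1 = - turn K x2 y2"

text \<open>
  Three arcs, any two of which cross exactly once. \<open>meet K A B\<close> is the parameter on \<open>A\<close> of the
  crossing of \<open>A\<close> with \<open>B\<close>.
\<close>

definition crosses_once :: "diagram \<Rightarrow> strand \<Rightarrow> strand \<Rightarrow> bool" where
  "crosses_once K A B \<longleftrightarrow> (\<exists>!x. \<exists>y. cross_at K A B x y)"

definition meet :: "diagram \<Rightarrow> strand \<Rightarrow> strand \<Rightarrow> real" where
  "meet K A B = (THE x. \<exists>y. cross_at K A B x y)"

definition triangle :: "complex set \<Rightarrow> diagram \<Rightarrow> strand \<Rightarrow> strand \<Rightarrow> strand \<Rightarrow> bool" where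
  "triangle D K A B C \<longleftrightarrow>
     crosses_once K A B \<and> crosses_once K A C \<and> crosses_once K B C \<and>
     double_points_in D K =
       {curve K (meet K A B), curve K (meet K A C), curve K (meet K B C)}"

text \<open>
  Pushing one arc of a triangle across the crossing of the other two: on each arc the two
  crossings are interchanged, and any two arcs still cross in the same direction.
\<close>

definition triangle_move ::
    "complex set \<Rightarrow> strand \<Rightarrow> strand \<Rightarrow> strand \<Rightarrow> diagram \<Rightarrow> diagram \<Rightarrow> bool" where
  "triangle_move D A B C K K' \<longleftrightarrow>
     triangle D K A B C \<and> triangle D K' A B C \<and>
     (meet K A B < meet K A C \<longleftrightarrow> meet K' A C < meet K' A B) \<and>
     (meet K B A < meet K B C \<longleftrightarrow> meet K' B C < meet K' B A) \<and>
     (meet K C A < meet K C B \<longleftrightarrow> meet K' C B < meet K' C A) \<and>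
     turn K (meet K A B) (meet K B A) = turn K' (meet K' A B) (meet K' B A) \<and>
     turn K (meet K A C) (meet K C A) = turn K' (meet K' A C) (meet K' C A) \<and>
     turn K (meet K B C) (meet K C B) = turn K' (meet K' B C) (meet K' C B)"

datatype move_type = C1 | C2 | C3 | V1 | V2 | V3 | V4 | T1 | T2 | T3

text \<open>
  Up to homeomorphisms of the disc, the tangles in the following rules are determined by the
  number of arcs and the order in which the arcs run through their double points. The conditions
  on the directions (\<open>turn\<close>) in \<open>bigon\<close> and \<open>triangle_move\<close>, and the equality of the signs in
  \<open>T3\<close>, hold automatically for tangles in a disc with fixed ends; they are recorded as part of
  the picture. Each rule describes one direction of a move, and no condition is imposed on the
  relative orientations of the arcs.
\<close>

inductive local_move :: "move_type \<Rightarrow> diagram \<Rightarrow> diagram \<Rightarrow> bool" where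
  C1: "local_move C1 K K'"
    if "tangle_replacement D [A] K K'"
       "bars_in [A] K = {}" "bars_in [A] K' = {}"
       "double_points_in D K = {}"
       "double_points_in D K' = {c}" "c \<notin> virtuals K'"
| C2: "local_move C2 K K'"
    if "tangle_replacement D [A, B] K K'"
       "bars_in [A, B] K = {}" "bars_in [A, B] K' = {}"
       "double_points_in D K = {}"
       "bigon D K' A B x1 y1 x2 y2"
       "x1 \<in> overs K'" "x2 \<in> overs K'"
       "virtuals K' \<inter> interior D = {}"
| C3: "local_move C3 K K'"
    if "tangle_replacement D [A, B, C] K K'"
       "bars_in [A, B, C] K = {}" "bars_in [A, B, C] K' = {}"
       "triangle_move D A B C K K'"
       "virtuals K \<inter> interior D = {}" "virtuals K' \<inter> interior D = {}"
       "meet K A B \<in> overs K" "meet K A C \<in> overs K" "meet K B C \<in> overs K"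
       "meet K' A B \<in> overs K'" "meet K' A C \<in> overs K'" "meet K' B C \<in> overs K'"
| V1: "local_move V1 K K'"
    if "tangle_replacement D [A] K K'"
       "bars_in [A] K = {}" "bars_in [A] K' = {}"
       "double_points_in D K = {}"
       "double_points_in D K' = {c}" "c \<in> virtuals K'"
| V2: "local_move V2 K K'"
    if "tangle_replacement D [A, B] K K'"
       "bars_in [A, B] K = {}" "bars_in [A, B] K' = {}"
       "double_points_in D K = {}"
       "bigon D K' A B x1 y1 x2 y2"
       "double_points_in D K' \<subseteq> virtuals K'"
| V3: "local_move V3 K K'"
    if "tangle_replacement D [A, B, C] K K'"
       "bars_in [A, B, C] K = {}" "bars_in [A, B, C] K' = {}"
       "triangle_move D A B C K K'"
       "double_points_in D K \<subseteq> virtuals K" "double_points_in D K' \<subseteq> virtuals K'"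
| V4: "local_move V4 K K'"
    if "tangle_replacement D [A, B, C] K K'"
       "bars_in [A, B, C] K = {}" "bars_in [A, B, C] K' = {}"
       "triangle_move D A B C K K'"
       "virtuals K \<inter> interior D = {curve K (meet K A B), curve K (meet K A C)}"
       "virtuals K' \<inter> interior D = {curve K' (meet K' A B), curve K' (meet K' A C)}"
       "meet K B C \<in> overs K" "meet K' B C \<in> overs K'"
| T1: "local_move T1 K K'"
    if "tangle_replacement D [A] K K'"
       "double_points_in D K = {}" "double_points_in D K' = {}"
       "bars_in [A] K = {}"
       "bars_in [A] K' = {u1, u2}" "u1 \<noteq> u2"
| T2: "local_move T2 K K'"
    if "tangle_replacement D [A, B] K K'"
       "single_crossing D K A B x y" "curve K x \<in> virtuals K"
       "single_crossing D K' A B x' y'" "curve K' x' \<in> virtuals K'"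
       "bars_in [A, B] K = {u}" "u \<in> interval A" "u < x"
       "bars_in [A, B] K' = {u'}" "u' \<in> interval A" "x' < u'"
| T3: "local_move T3 K K'"
    if "tangle_replacement D [A, B] K K'"
       "single_crossing D K A B x y" "curve K x \<notin> virtuals K"
       "bars_in [A, B] K = {u1, u2, w1, w2}"
       "u1 \<in> interval A" "u2 \<in> interval A" "u1 < x" "x < u2"
       "w1 \<in> interval B" "w2 \<in> interval B" "w1 < y" "y < w2"
       "cross_at K' A B x1 y1" "cross_at K' A B x2 y2" "cross_at K' A B x3 y3"
       "x1 < x2" "x2 < x3"
       "(y1 < y2 \<and> y2 < y3) \<or> (y3 < y2 \<and> y2 < y1)"
       "double_points_in D K' = {curve K' x1, curve K' x2, curve K' x3}"
       "curve K' x1 \<in> virtuals K'" "curve K' x2 \<notin> virtuals K'" "curve K' x3 \<in> virtuals K'"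
       "bars_in [A, B] K' = {}"
       "x2 \<in> overs K' \<longleftrightarrow> x \<notin> overs K"
       "crossing_sign K' (curve K' x2) = crossing_sign K (curve K x)"

definition reidemeister_move :: "move_type \<Rightarrow> diagram \<Rightarrow> diagram \<Rightarrow> bool" where
  "reidemeister_move m K K' \<longleftrightarrow>
     (\<exists>L L'. twisted_knot_diagram L \<and> twisted_knot_diagram L' \<and>
        planar_isotopic K L \<and> (local_move m L L' \<or> local_move m L' L) \<and> planar_isotopic L' K')"

end

theory Submission
  imports Defs
begin

text \<open>
  Modulo 2, signs and over/under information drop out of the affine index: for a crossing with
  parameters \<open>a\<close> and \<open>b\<close> it is the number of classical passages between \<open>a\<close> and \<open>b\<close>, hence the
  number of passages below \<open>a\<close> plus the number of those below \<open>b\<close>, plus one. The same holds for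
  the zero affine index, with zero crossings only, and for the bar parities, with bars. Each
  crossing therefore contributes a term determined by its sign and by such counts at its two
  parameters, and the two components play symmetric roles. A local move changes none of the counts
  outside the disc modulo 2, and the counts inside only depend on the order of the passages along
  each arc. Hence outer crossings keep their terms, a kink contributes 0, the two crossings of a
  bigon have equal weights and opposite signs, and the crossings of a triangle keep their
  terms.
\<close>

section \<open>Parity formulas\<close>

text \<open>Smoothing a crossing produces two cyclic arcs, and how these run through the disc of a
  move depends on how the strands are joined outside it. Counting from the base point removes this
  case distinction: a crossing is described by one count at each of its two parameters, and each
  count is compared before and after the move along its own strand, whatever the orientations and
  the connections outside. For passages this works because their total number is even, so that both
  arcs have the same parity; the total number of bars may be odd and is carried along as a separate
  datum.

  The data are layered. Classical passages decide which crossings are zero crossings, and only then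
  is it determined which passages enter the exponent of \<open>s_var\<close>. Every comparison
  therefore settles the classical passages before it can speak of passages through zero
  crossings.\<close>

definition passages :: "diagram \<Rightarrow> complex set \<Rightarrow> real set" where
  "passages K C = {x\<in>{0..<1}. curve K x \<in> C}"

definition count_below :: "real set \<Rightarrow> real \<Rightarrow> nat" where
  "count_below S a = card (S \<inter> {..<a})"

text \<open>Here \<open>q\<close> stands for the total number of bars. The two components share all
  bars between them, so if one has parity \<open>p\<close>, the other has the parity of
  \<open>p + q\<close>. Exchanging the components only exchanges the two factors.\<close>

definition crossing_weight :: "nat \<Rightarrow> nat \<Rightarrow> nat \<Rightarrow> int poly poly" where
  "crossing_weight w p q =
     (s_var ^ w * t_var ^ (p mod 2) - 1) * (s_var ^ w * t_var ^ ((p + q) mod 2) - 1)"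

text \<open>The two sums in \<open>Qz\<close> differ only in the exponent of \<open>s_var\<close>.
  The value 1 outside the zero crossings merges them into a single sum over all classical
  crossings.\<close>

definition s_exponent :: "diagram \<Rightarrow> complex \<Rightarrow> nat" where
  "s_exponent K c = (if c \<in> zero_crossings K then z_parity K c else 1)"

definition crossing_term :: "diagram \<Rightarrow> complex \<Rightarrow> int poly poly" where
  "crossing_term K c = of_int (crossing_sign K c)
     * (s_var ^ s_exponent K c * t_var ^ bar_parity K c 0 - 1)
     * (s_var ^ s_exponent K c * t_var ^ bar_parity K c 1 - 1)"

lemma crossing_weight_cong:
  assumes "w = w'" "even p = even p'" "even q = even q'"
  shows "crossing_weight w p q = crossing_weight w' p' q'"
proof -
  have "p mod 2 = p' mod 2" "(p + q) mod 2 = (p' + q') mod 2"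
    using assms(2,3) by presburger+
  thus ?thesis unfolding crossing_weight_def assms(1) by (simp only:)
qed

lemma zero_crossings_subset: "zero_crossings K \<subseteq> classical_crossings K"
  by (auto simp: zero_crossings_def)

lemma finite_classical_crossings:
  "twisted_knot_diagram K \<Longrightarrow> finite (classical_crossings K)"
  by (simp add: twisted_knot_diagram_def generic_closed_curve_def classical_crossings_def)

lemma Qz_eq_sum:
  assumes "twisted_knot_diagram K"
  shows "Qz K = (\<Sum>c\<in>classical_crossings K. crossing_term K c)"
proof -
  have "(\<Sum>c\<in>classical_crossings K. crossing_term K c) =
     (\<Sum>c\<in>classical_crossings K - zero_crossings K. crossing_term K c) +
     (\<Sum>c\<in>zero_crossings K. crossing_term K c)"
    by (rule sum.subset_diff[OF zero_crossings_subset finite_classical_crossings[OF assms]])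
  also have "\<dots> = Qz K"
    unfolding Qz_def crossing_term_def s_exponent_def
    by (subst add.commute, intro arg_cong2[where f = "(+)"] sum.cong refl) (simp_all only: if_True if_False Diff_iff power_one_right)
  finally show ?thesis by simp
qed

section \<open>The two parameters of a crossing\<close>

lemma no_triple_point:
  assumes "twisted_knot_diagram K" "x \<in> {0..<1}" "y \<in> {0..<1}" "w \<in> {0..<1}"
    "curve K x = curve K y" "curve K w = curve K x" "x \<noteq> y"
  shows "w = x \<or> w = y"
proof -
  have "\<forall>x\<in>{0..<1}. \<forall>y\<in>{0..<1}. \<forall>w\<in>{0..<1}.
      curve K x = curve K y \<and> curve K y = curve K w \<longrightarrow> x = y \<or> y = w \<or> x = w"
    using assms(1) unfolding twisted_knot_diagram_def generic_closed_curve_def by (elim conjE)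
  from this[rule_format, OF assms(2-4)] assms(5-7) show ?thesis by auto
qed

lemma passages_eq_pair:
  assumes "twisted_knot_diagram K" "x \<in> {0..<1}" "y \<in> {0..<1}" "x \<noteq> y" "curve K x = curve K y"
  shows "passages K {curve K x} = {x, y}"
  using assms no_triple_point[OF assms(1,2,3)] by (auto simp: passages_def)

lemma overs_iff:
  assumes "twisted_knot_diagram K" "x \<in> {0..<1}" "y \<in> {0..<1}" "x \<noteq> y" "curve K x = curve K y"
    "curve K x \<in> classical_crossings K"
  shows "x \<in> overs K \<longleftrightarrow> y \<notin> overs K"
proof -
  have "\<forall>x\<in>{0..<1}. \<forall>y\<in>{0..<1}.
      x \<noteq> y \<and> curve K x = curve K y \<and> curve K x \<in> classical_crossings K \<longrightarrow>
      (x \<in> overs K \<longleftrightarrow> y \<notin> overs K)"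
    using assms(1) unfolding twisted_knot_diagram_def by (elim conjE)
  from this[rule_format, OF assms(2,3)] assms(4-6) show ?thesis by auto
qed

lemma over_param_eqI:
  assumes "twisted_knot_diagram K" "x \<in> {0..<1}" "curve K x = c" "c \<in> classical_crossings K"
    "x \<in> overs K"
  shows "over_param K c = x"
  unfolding over_param_def
proof (rule the_equality)
  show "y = x" if "y \<in> {0..<1} \<and> curve K y = c \<and> y \<in> overs K" for y
    using overs_iff[OF assms(1), of y x] that assms by metis
qed (use assms in simp)

lemma under_param_eqI:
  assumes "twisted_knot_diagram K" "x \<in> {0..<1}" "curve K x = c" "c \<in> classical_crossings K"
    "x \<notin> overs K"
  shows "under_param K c = x"
  unfolding under_param_def
proof (rule the_equality)
  show "y = x" if "y \<in> {0..<1} \<and> curve K y = c \<and> y \<notin> overs K" for y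
    using overs_iff[OF assms(1), of y x] that assms by metis
qed (use assms in simp)

text \<open>Replaces the definite descriptions \<open>over_param\<close> and
  \<open>under_param\<close> by two concrete parameters, which are the only ones over
  \<open>c\<close> because triple points are excluded.\<close>

lemma classical_crossing_params:
  assumes "twisted_knot_diagram K" "c \<in> classical_crossings K"
  obtains x y where "x \<in> {0..<1}" "y \<in> {0..<1}" "x \<noteq> y" "curve K x = c" "curve K y = c"
    "x \<in> overs K" "y \<notin> overs K" "over_param K c = x" "under_param K c = y" "passages K {c} = {x, y}"
proof -
  obtain x y where xy: "x \<in> {0..<1}" "y \<in> {0..<1}" "x \<noteq> y" "curve K x = c" "curve K y = c"
    using assms(2) unfolding classical_crossings_def double_points_def by blast
  have ov: "x \<in> overs K \<longleftrightarrow> y \<notin> overs K"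
    using overs_iff[OF assms(1) xy(1,2,3)] xy(4,5) assms(2) by simp
  have ps: "passages K {c} = {x, y}"
    using passages_eq_pair[OF assms(1) xy(1,2,3)] xy(4,5) by simp
  show ?thesis
  proof (cases "x \<in> overs K")
    case True
    thus ?thesis using that[OF xy] ov ps xy
      over_param_eqI[OF assms(1) xy(1,4) assms(2)] under_param_eqI[OF assms(1) xy(2,5) assms(2)]
      by blast
  next
    case False
    thus ?thesis using that[OF xy(2,1) xy(3)[symmetric] xy(5,4)] ov ps xy
      over_param_eqI[OF assms(1) xy(2,5) assms(2)] under_param_eqI[OF assms(1) xy(1,4) assms(2)]
      by blast
  qed
qed

text \<open>Each classical crossing is passed exactly twice, and different crossings have disjoint
  sets of passages.\<close>

lemma
  assumes "twisted_knot_diagram K" "C \<subseteq> classical_crossings K"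
  shows finite_passages: "finite (passages K C)"
    and even_card_passages: "even (card (passages K C))"
proof -
  have fin: "finite C"
    using assms finite_classical_crossings finite_subset by blast
  have two: "finite (passages K {c}) \<and> card (passages K {c}) = 2" if "c \<in> C" for c
    using classical_crossing_params[OF assms(1), of c] that assms(2)
    by (metis card_2_iff card.infinite in_mono zero_neq_numeral)
  have un: "passages K C = (\<Union>c\<in>C. passages K {c})"
    by (auto simp: passages_def)
  show "finite (passages K C)"
    unfolding un using fin two by blast
  have "card (passages K C) = (\<Sum>c\<in>C. card (passages K {c}))"
    unfolding un using fin two by (intro card_UN_disjoint) (auto simp: passages_def)
  thus "even (card (passages K C))"
    using two by simp
qed

section \<open>Indices as counts of passages\<close>

lemma odd_crossing_sign: "odd (crossing_sign K c)"
  by (simp add: crossing_sign_def turn_def)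

lemma component_subset: "component K c l \<subseteq> {0..<1}"
  by (auto simp: component_def open_arc_def)

lemma even_affine_index_iff:
  assumes "twisted_knot_diagram K"
  shows "even (affine_index K c l) \<longleftrightarrow>
    even (card (passages K (classical_crossings K) \<inter> component K c l))"
proof -
  have eq: "{x. x \<in> component K c l \<and> curve K x \<in> classical_crossings K} =
      passages K (classical_crossings K) \<inter> component K c l"
    using component_subset[of K c l] by (auto simp: passages_def)
  have "finite (passages K (classical_crossings K) \<inter> component K c l)"
    using finite_passages[OF assms] by blast
  thus ?thesis
    unfolding affine_index_def eq by (simp add: even_sum_iff odd_crossing_sign Int_def)
qed

lemma even_zero_affine_index_iff:
  assumes "twisted_knot_diagram K"
  shows "even (zero_affine_index K c l) \<longleftrightarrow>
    even (card (passages K (zero_crossings K) \<inter> component K c l))"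
proof -
  have eq: "{x. x \<in> component K c l \<and> curve K x \<in> zero_crossings K} =
      passages K (zero_crossings K) \<inter> component K c l"
    using component_subset[of K c l] by (auto simp: passages_def)
  have "finite (passages K (zero_crossings K) \<inter> component K c l)"
    using finite_passages[OF assms zero_crossings_subset] by blast
  thus ?thesis
    unfolding zero_affine_index_def eq by (simp add: even_sum_iff odd_crossing_sign Int_def)
qed

lemma frac_diff_unit_interval:
  fixes a x :: real
  assumes "a \<in> {0..<1}" "x \<in> {0..<1}"
  shows "frac (x - a) = (if a \<le> x then x - a else x - a + 1)"
  using assms by (auto simp: frac_unique_iff)

text \<open>Cuts the circle open at the base point. An arc that does not meet the base point is an
  interval; the opposite arc wraps around and is the complement of the closed interval.\<close>

lemma
  assumes "a \<in> {0..<1}" "b \<in> {0..<1}" "a < b"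
  shows open_arc_forward: "open_arc a b = {a<..<b}"
    and open_arc_backward: "open_arc b a = {0..<1} - {a..b}"
proof -
  have "frac (b - a) = b - a" "frac (a - b) = a - b + 1"
    using frac_diff_unit_interval[of a b] frac_diff_unit_interval[of b a] assms by auto
  moreover have "x \<in> open_arc c d \<longleftrightarrow> x \<in> {0..<1} \<and>
      0 < (if c \<le> x then x - c else x - c + 1) \<and>
      (if c \<le> x then x - c else x - c + 1) < frac (d - c)"
    if "c \<in> {0..<1}" for c d x
    unfolding open_arc_def using frac_diff_unit_interval[OF that, of x]
    by (auto simp del: frac_gt_0_iff)
  ultimately show "open_arc a b = {a<..<b}" "open_arc b a = {0..<1} - {a..b}"
    using assms by (auto simp del: frac_gt_0_iff split: if_splits)
qed

text \<open>The arcs omit their end points. In the applications these are the two passages of one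
  crossing, so they belong to \<open>S\<close> together or not at all, which gives the corrections
  by 1 and by 2.\<close>

lemma
  assumes "finite S" "S \<subseteq> {0..<1}" "a \<in> {0..<1}" "b \<in> {0..<1}" "a < b" "a \<in> S \<longleftrightarrow> b \<in> S"
  shows card_forward_arc:
      "count_below S b = card (S \<inter> open_arc a b) + count_below S a + of_bool (a \<in> S)"
    and card_both_arcs:
      "card S = card (S \<inter> open_arc b a) + card (S \<inter> open_arc a b) + 2 * of_bool (a \<in> S)"
proof -
  have "S \<inter> {..<b} = (S \<inter> {a<..<b}) \<union> (S \<inter> {..<a}) \<union> (S \<inter> {a})"
    using assms(5) by auto
  hence "card (S \<inter> {..<b}) = card (S \<inter> {a<..<b}) + card (S \<inter> {..<a}) + card (S \<inter> {a})"
    using assms(1) by (simp add: card_Un_disjoint Int_Un_distrib2 disjoint_iff)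
  thus "count_below S b = card (S \<inter> open_arc a b) + count_below S a + of_bool (a \<in> S)"
    by (simp add: count_below_def open_arc_forward[OF assms(3-5)])
  have split: "S - {a<..<b} = (S \<inter> ({0..<1} - {a..b})) \<union> (S \<inter> {a, b})"
    using assms(2,5) by auto
  have "card (S - {a<..<b}) = card (S \<inter> ({0..<1} - {a..b})) + card (S \<inter> {a, b})"
    unfolding split using assms(1,5) by (intro card_Un_disjoint) auto
  moreover have "card (S \<inter> {a, b}) = 2 * of_bool (a \<in> S)"
    using assms(5,6) by (cases "a \<in> S") auto
  ultimately show
    "card S = card (S \<inter> open_arc b a) + card (S \<inter> open_arc a b) + 2 * of_bool (a \<in> S)"
    using card_Int_Diff[OF assms(1), of "{a<..<b}"]
    by (simp add: open_arc_forward[OF assms(3-5)] open_arc_backward[OF assms(3-5)])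
qed

text \<open>If \<open>b < a\<close>, the arc wraps around the base point. Since
  \<open>card S\<close> is even, it then has the same parity as the opposite arc, which is an
  interval; hence the formula is symmetric in \<open>a\<close> and \<open>b\<close>.\<close>

lemma even_card_arc_iff:
  assumes "finite S" "S \<subseteq> {0..<1}" "a \<in> {0..<1}" "b \<in> {0..<1}" "a \<noteq> b" "a \<in> S \<longleftrightarrow> b \<in> S"
    "even (card S)"
  shows "even (card (S \<inter> open_arc a b)) \<longleftrightarrow>
    even (count_below S a + count_below S b + of_bool (a \<in> S))"
proof (cases "a < b")
  case True
  thus ?thesis
    using card_forward_arc[OF assms(1-4) True assms(6)] by auto
next
  case False
  hence "b < a" using assms(5) by simp
  thus ?thesis
    using card_forward_arc[OF assms(1,2,4,3) _ assms(6)[symmetric]]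
      card_both_arcs[OF assms(1,2,4,3) _ assms(6)[symmetric]] assms(6,7)
    by (auto simp: even_add)
qed

lemma passages_unit_interval: "passages K C \<subseteq> {0..<1}"
  by (auto simp: passages_def)

text \<open>By symmetry in \<open>a\<close> and \<open>b\<close>, neither the label \<open>l\<close>
  nor the choice of the over passage matters. The last summand is the earlier passage of
  \<open>c\<close>: it is counted below the later one but lies on neither component.\<close>

lemma even_card_component_iff:
  assumes K: "twisted_knot_diagram K" and c: "c \<in> classical_crossings K"
    and ab: "a \<in> {0..<1}" "b \<in> {0..<1}" "a \<noteq> b" "curve K a = c" "curve K b = c"
    and C: "C \<subseteq> classical_crossings K"
  shows "even (card (passages K C \<inter> component K c l)) \<longleftrightarrow>
    even (count_below (passages K C) a + count_below (passages K C) b + of_bool (c \<in> C))"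
proof -
  obtain x y where xy: "over_param K c = x" "under_param K c = y" "passages K {c} = {x, y}"
    using classical_crossing_params[OF K c] by metis
  have "{x, y} = {a, b}"
    using passages_eq_pair[OF K ab(1-3)] xy(3) ab(4,5) by simp
  hence "(x, y) = (a, b) \<or> (x, y) = (b, a)"
    by (auto simp: doubleton_eq_iff)
  moreover have mem: "a \<in> passages K C \<longleftrightarrow> c \<in> C" "b \<in> passages K C \<longleftrightarrow> c \<in> C"
    using ab by (auto simp: passages_def)
  moreover note even_card_arc_iff[OF finite_passages[OF K C] passages_unit_interval ab(1-3) _
      even_card_passages[OF K C]]
    even_card_arc_iff[OF finite_passages[OF K C] passages_unit_interval ab(2,1) ab(3)[symmetric] _
      even_card_passages[OF K C]]
  ultimately show ?thesis
    by (auto simp: component_def xy even_add)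
qed

text \<open>Odd and not even, because \<open>c\<close> is itself classical and so its own earlier
  passage is among those counted. The same shift by one occurs for \<open>z_parity\<close> at a zero
  crossing.\<close>

lemma zero_crossing_iff:
  assumes "twisted_knot_diagram K" "c \<in> classical_crossings K"
    "a \<in> {0..<1}" "b \<in> {0..<1}" "a \<noteq> b" "curve K a = c" "curve K b = c"
  shows "c \<in> zero_crossings K \<longleftrightarrow>
    odd (count_below (passages K (classical_crossings K)) a
       + count_below (passages K (classical_crossings K)) b)"
  using assms(2) even_card_component_iff[OF assms order_refl]
  by (auto simp: zero_crossings_def even_affine_index_iff[OF assms(1)])

lemma z_parity_eq:
  assumes "twisted_knot_diagram K" "c \<in> zero_crossings K"
    "a \<in> {0..<1}" "b \<in> {0..<1}" "a \<noteq> b" "curve K a = c" "curve K b = c"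
  shows "z_parity K c = of_bool
    (even (count_below (passages K (zero_crossings K)) a
         + count_below (passages K (zero_crossings K)) b))"
proof -
  have "c \<in> classical_crossings K" using assms(2) zero_crossings_subset by blast
  note even_card_component_iff[OF assms(1) this assms(3-7) zero_crossings_subset, of 0]
  hence "even (zero_affine_index K c 0) \<longleftrightarrow>
    odd (count_below (passages K (zero_crossings K)) a
         + count_below (passages K (zero_crossings K)) b)"
    using assms(2) by (simp add: even_zero_affine_index_iff[OF assms(1)])
  thus ?thesis
    by (auto simp: z_parity_def parity_cases even_iff_mod_2_eq_zero odd_iff_mod_2_eq_one)
qed

lemma bars_facts:
  assumes "twisted_knot_diagram K"
  shows "finite (bars K)" "bars K \<subseteq> {0..<1}"
    "x \<in> bars K \<Longrightarrow> curve K x \<notin> double_points K"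
  using assms unfolding twisted_knot_diagram_def by auto

text \<open>Bars avoid crossings, so no end point has to be corrected for. The two components may
  differ in bar parity, but the product of the two factors does not see which component is which,
  and the passages may be named in either order.\<close>

lemma crossing_term_eq:
  assumes K: "twisted_knot_diagram K" and c: "c \<in> classical_crossings K"
    and ab: "a \<in> {0..<1}" "b \<in> {0..<1}" "a \<noteq> b" "curve K a = c" "curve K b = c"
  shows "crossing_term K c = of_int (crossing_sign K c) *
    crossing_weight (s_exponent K c) (count_below (bars K) a + count_below (bars K) b)
      (card (bars K))"
proof -
  let ?S = "bars K" and ?w = "s_exponent K c"
  let ?r = "count_below ?S"
  have nb: "a \<notin> ?S" "b \<notin> ?S"
    using c ab bars_facts(3)[OF K, of a] bars_facts(3)[OF K, of b]
    unfolding classical_crossings_def by auto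
  have main: "(s_var ^ ?w * t_var ^ (card (?S \<inter> open_arc x y) mod 2) - 1) *
     (s_var ^ ?w * t_var ^ (card (?S \<inter> open_arc y x) mod 2) - 1) =
     crossing_weight ?w (?r x + ?r y) (card ?S)"
    if "x < y" "x \<in> {0..<1}" "y \<in> {0..<1}" "x \<notin> ?S" "y \<notin> ?S" for x y
  proof -
    have "?r y = card (?S \<inter> open_arc x y) + ?r x"
      "card ?S = card (?S \<inter> open_arc y x) + card (?S \<inter> open_arc x y)"
      using card_forward_arc[of ?S x y] card_both_arcs[of ?S x y] bars_facts[OF K] that by auto
    hence "card (?S \<inter> open_arc x y) mod 2 = (?r x + ?r y) mod 2"
      "card (?S \<inter> open_arc y x) mod 2 = (?r x + ?r y + card ?S) mod 2"
      by presburger+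
    thus ?thesis by (simp add: crossing_weight_def)
  qed
  obtain x y where xy: "over_param K c = x" "under_param K c = y" "passages K {c} = {x, y}"
    using classical_crossing_params[OF K c] by metis
  have "{x, y} = {a, b}"
    using passages_eq_pair[OF K ab(1-3)] xy(3) ab(4,5) by simp
  hence "(x, y) = (a, b) \<or> (x, y) = (b, a)"
    by (auto simp: doubleton_eq_iff)
  moreover have "a < b \<or> b < a" using ab(3) by auto
  ultimately have "(s_var ^ ?w * t_var ^ (card (?S \<inter> open_arc x y) mod 2) - 1) *
     (s_var ^ ?w * t_var ^ (card (?S \<inter> open_arc y x) mod 2) - 1) =
     crossing_weight ?w (?r a + ?r b) (card ?S)"
    using main[of a b] main[of b a] ab(1,2) nb by (auto simp: mult.commute add.commute)
  thus ?thesis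
    by (simp add: crossing_term_def bar_parity_def component_def xy mult.assoc)
qed

section \<open>Replacing a tangle\<close>

text \<open>Equality modulo 2 is demanded strand by strand and not for the disc as a whole: an outer
  parameter may lie between two strands, and then only some of them are below it.\<close>

definition parity_agree :: "strand list \<Rightarrow> real set \<Rightarrow> real set \<Rightarrow> bool" where
  "parity_agree As S S' \<longleftrightarrow> S - inner As = S' - inner As \<and>
     (\<forall>A\<in>set As. even (card (S \<inter> interval A)) = even (card (S' \<inter> interval A)))"

definition local_count :: "real set \<Rightarrow> strand \<Rightarrow> real \<Rightarrow> nat" where
  "local_count S A a = card (S \<inter> interval A \<inter> {..<a})"

lemma tangle_strands_disjoint:
  assumes "tangle_in_disc D As K" "A \<in> set As" "B \<in> set As" "A \<noteq> B"
  shows "{fst A..snd A} \<inter> {fst B..snd B} = {}"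
  using assms unfolding tangle_in_disc_def by (metis in_set_conv_nth)

lemma tangle_intervals_disjoint:
  assumes "tangle_in_disc D As K" "A \<in> set As" "B \<in> set As" "A \<noteq> B"
  shows "interval A \<inter> interval B = {}"
proof -
  have "interval X \<subseteq> {fst X..snd X}" for X by (auto simp: interval_def)
  thus ?thesis using tangle_strands_disjoint[OF assms] by blast
qed

lemma tangle_strand_bounds:
  assumes "tangle_in_disc D As K" "A \<in> set As"
  shows "0 < fst A" "fst A < snd A" "snd A < 1"
  using assms unfolding tangle_in_disc_def by auto

lemma interval_unit:
  assumes "tangle_in_disc D As K" "A \<in> set As"
  shows "interval A \<subseteq> {0..<1}"
  using tangle_strand_bounds[OF assms] by (auto simp: interval_def)

lemma tangle_interior_iff:
  assumes "tangle_in_disc D As K" "x \<in> {0..<1}"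
  shows "curve K x \<in> interior D \<longleftrightarrow> x \<in> inner As"
  using assms unfolding tangle_in_disc_def by blast

text \<open>The curve meets the frontier of the disc only at strand ends, and there injectively.
  Double points must stay away from the ends, because there \<open>K\<close> and \<open>K'\<close>
  agree a priori on one side only, which is not enough to compare velocities by agreement near the
  parameter.\<close>

lemma double_point_not_end:
  assumes "tangle_in_disc D As K" "x \<in> {0..<1}" "y \<in> {0..<1}" "x \<noteq> y" "curve K x = curve K y"
  shows "x \<notin> ends As"
proof
  assume x: "x \<in> ends As"
  have fr: "\<forall>x\<in>{0..<1}. curve K x \<in> frontier D \<longleftrightarrow> x \<in> ends As" "inj_on (curve K) (ends As)"
    using assms(1) unfolding tangle_in_disc_def by auto
  hence "y \<in> ends As" using assms x by metis
  thus False using fr(2) x assms(4,5) by (metis inj_onD)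
qed

text \<open>Since \<open>T\<close> cuts through no strand, a count on \<open>T\<close> is an outer
  part, the same for both sets, plus a sum over whole strands, which agrees modulo 2.\<close>

lemma even_card_Int_agree:
  assumes tg: "tangle_in_disc D As K" and ag: "parity_agree As S S'"
    and fin: "finite S" "finite S'"
    and T: "\<And>A. A \<in> set As \<Longrightarrow> interval A \<subseteq> T \<or> interval A \<inter> T = {}"
  shows "even (card (S \<inter> T)) = even (card (S' \<inter> T))"
proof -
  let ?I = "{A\<in>set As. interval A \<subseteq> T}"
  have card: "card (R \<inter> T) = card ((R - inner As) \<inter> T) + (\<Sum>A\<in>?I. card (R \<inter> interval A))"
    if "finite R" for R
  proof -
    have "R \<inter> T = ((R - inner As) \<inter> T) \<union> (\<Union>A\<in>?I. R \<inter> interval A)"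
      using T unfolding inner_def by blast
    moreover have "card (((R - inner As) \<inter> T) \<union> (\<Union>A\<in>?I. R \<inter> interval A)) =
        card ((R - inner As) \<inter> T) + card (\<Union>A\<in>?I. R \<inter> interval A)"
      using that by (intro card_Un_disjoint) (auto simp: inner_def)
    moreover have "card (\<Union>A\<in>?I. R \<inter> interval A) = (\<Sum>A\<in>?I. card (R \<inter> interval A))"
    proof (intro card_UN_disjoint ballI impI)
      fix A B assume "A \<in> ?I" "B \<in> ?I" "A \<noteq> B"
      hence "interval A \<inter> interval B = {}"
        using tangle_intervals_disjoint[OF tg, of A B] by blast
      thus "(R \<inter> interval A) \<inter> (R \<inter> interval B) = {}" by blast
    qed (use that in auto)
    ultimately show ?thesis by simp
  qed
  have "{A\<in>?I. odd (card (S \<inter> interval A))} = {A\<in>?I. odd (card (S' \<inter> interval A))}"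
    using ag unfolding parity_agree_def by auto
  hence "even (\<Sum>A\<in>?I. card (S \<inter> interval A)) = even (\<Sum>A\<in>?I. card (S' \<inter> interval A))"
    by (simp add: even_sum_iff)
  moreover have "S - inner As = S' - inner As"
    using ag unfolding parity_agree_def by auto
  ultimately show ?thesis
    using card[OF fin(1)] card[OF fin(2)] by simp
qed

lemma even_count_below_outside:
  assumes "tangle_in_disc D As K" "parity_agree As S S'" "finite S" "finite S'" "a \<notin> inner As"
  shows "even (count_below S a) = even (count_below S' a)"
  unfolding count_below_def
proof (rule even_card_Int_agree[OF assms(1-4)])
  show "interval A \<subseteq> {..<a} \<or> interval A \<inter> {..<a} = {}" if "A \<in> set As" for A
    using assms(5) that by (auto simp: inner_def interval_def)
qed

lemma even_card_until_strand:
  assumes "tangle_in_disc D As K" "parity_agree As S S'" "finite S" "finite S'" "A \<in> set As"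
  shows "even (card (S \<inter> {..fst A})) = even (card (S' \<inter> {..fst A}))"
proof (rule even_card_Int_agree[OF assms(1-4)])
  show "interval B \<subseteq> {..fst A} \<or> interval B \<inter> {..fst A} = {}" if "B \<in> set As" for B
  proof (cases "B = A")
    case False
    hence "fst A \<notin> {fst B..snd B}"
      using tangle_strands_disjoint[OF assms(1,5) that] tangle_strand_bounds[OF assms(1,5)]
      by auto
    thus ?thesis by (auto simp: interval_def)
  qed (auto simp: interval_def)
qed

lemma even_card_agree:
  assumes "tangle_in_disc D As K" "parity_agree As S S'" "finite S" "finite S'"
  shows "even (card S) = even (card S')"
  using even_card_Int_agree[OF assms, of UNIV] by simp

lemma count_below_inside:
  assumes "finite S" "a \<in> interval A"
  shows "count_below S a = card (S \<inter> {..fst A}) + local_count S A a"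
proof -
  have "S \<inter> {..<a} = (S \<inter> {..fst A}) \<union> (S \<inter> interval A \<inter> {..<a})"
    using assms(2) by (auto simp: interval_def)
  moreover have "card ((S \<inter> {..fst A}) \<union> (S \<inter> interval A \<inter> {..<a})) =
      card (S \<inter> {..fst A}) + card (S \<inter> interval A \<inter> {..<a})"
    using assms(1) by (intro card_Un_disjoint) (auto simp: interval_def)
  ultimately show ?thesis by (simp add: count_below_def local_count_def)
qed

text \<open>A move may shift a crossing along its strands, so \<open>a'\<close> and
  \<open>b'\<close> need not equal \<open>a\<close> and \<open>b\<close>. The counts up to the
  beginning of a strand agree modulo 2 in any case; what remains is local to the strand and depends
  only on the order of the passages there.\<close>

lemma even_count_below_inside:
  assumes "tangle_in_disc D As K" "parity_agree As S S'" "finite S" "finite S'"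
    "A \<in> set As" "B \<in> set As" "a \<in> interval A" "b \<in> interval B" "a' \<in> interval A" "b' \<in> interval B"
    "even (local_count S A a + local_count S B b) = even (local_count S' A a' + local_count S' B b')"
  shows "even (count_below S a + count_below S b) = even (count_below S' a' + count_below S' b')"
  using even_card_until_strand[OF assms(1-5)] even_card_until_strand[OF assms(1-4,6)] assms(11)
    count_below_inside[OF assms(3,7)] count_below_inside[OF assms(3,8)]
    count_below_inside[OF assms(4,9)] count_below_inside[OF assms(4,10)]
  by (auto simp: even_add)

lemma cross_at_facts:
  assumes tw: "twisted_knot_diagram K" and tg: "tangle_in_disc D As K"
    and AB: "A \<in> set As" "B \<in> set As" "A \<noteq> B" and cr: "cross_at K A B x y"
  shows "x \<in> {0..<1}" "y \<in> {0..<1}" "x \<noteq> y" "x \<in> interval A" "y \<in> interval B"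
    "curve K y = curve K x" "curve K x \<in> double_points K" "curve K x \<in> interior D"
    "passages K {curve K x} = {x, y}"
proof -
  show 1: "x \<in> interval A" "y \<in> interval B" "curve K y = curve K x"
    using cr by (auto simp: cross_at_def)
  show 2: "x \<in> {0..<1}" "y \<in> {0..<1}"
    using 1 interval_unit[OF tg AB(1)] interval_unit[OF tg AB(2)] by auto
  show 3: "x \<noteq> y"
    using tangle_intervals_disjoint[OF tg AB] 1 by auto
  show "curve K x \<in> double_points K"
    using 1 2 3 unfolding double_points_def by force
  show "curve K x \<in> interior D"
    using tangle_interior_iff[OF tg 2(1)] 1(1) AB(1) by (auto simp: inner_def)
  show "passages K {curve K x} = {x, y}"
    using passages_eq_pair[OF tw 2 3] 1(3) by simp
qed

lemma passages_Int_interval: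
  assumes "tangle_in_disc D As K" "A \<in> set As"
  shows "passages K C \<inter> interval A = {x\<in>interval A. curve K x \<in> C \<inter> interior D}"
  using assms interval_unit[OF assms] tangle_interior_iff[OF assms(1)]
  by (auto simp: passages_def inner_def)

section \<open>Two diagrams that agree outside a disc\<close>

locale replacement =
  fixes D :: "complex set" and As :: "strand list" and K K' :: diagram
  assumes repl: "tangle_replacement D As K K'"
begin

lemma
  shows tw: "twisted_knot_diagram K" and tw': "twisted_knot_diagram K'"
    and tg: "tangle_in_disc D As K" and tg': "tangle_in_disc D As K'"
    and agree: "agree_outside D As K K'"
  using repl unfolding tangle_replacement_def by auto

lemma replacement_sym: "replacement D As K' K"
  using repl unfolding replacement_def tangle_replacement_def agree_outside_def by auto

lemma curve_outside: "x \<in> {0..<1} \<Longrightarrow> x \<notin> inner As \<Longrightarrow> curve K' x = curve K x"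
  using agree unfolding agree_outside_def by (metis DiffI)

lemma velocity_outside:
  assumes "x \<in> {0..<1}" "x \<notin> inner As" "x \<notin> ends As"
  shows "velocity K x = velocity K' x"
proof -
  define F where "F = (\<Union>A\<in>set As. {fst A..snd A})"
  \<comment> \<open>A neighbourhood of the parameter 0 reaches below 0, where periodicity identifies
    it with parameters just below 1. The strands have to be avoided there too, hence their
    translates by -1.\<close>
  define F1 where "F1 = (\<Union>A\<in>set As. {fst A - 1..snd A - 1})"
  define U where "U = {-1<..<1} - F - F1"
  have "closed F" "closed F1" unfolding F_def F1_def by auto
  hence U: "open U" unfolding U_def by (intro open_Diff) auto
  have inner_F: "inner As \<subseteq> F" by (force simp: inner_def F_def interval_def)
  have "x \<notin> F"
    using assms(2,3) by (force simp: F_def inner_def ends_def interval_def)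
  moreover have "x \<notin> F1"
    using assms(1) tangle_strand_bounds[OF tg] by (force simp: F1_def)
  ultimately have xU: "x \<in> U" using assms(1) by (auto simp: U_def)
  have per: "curve L (y + 1) = curve L y" if "twisted_knot_diagram L" for L y
    using that unfolding twisted_knot_diagram_def generic_closed_curve_def by auto
  have eq: "curve K y = curve K' y" if "y \<in> U" for y
  proof (cases "0 \<le> y")
    case True
    hence "y \<in> {0..<1}" "y \<notin> inner As" using that inner_F by (auto simp: U_def)
    thus ?thesis using curve_outside[of y] by simp
  next
    case False
    hence "y + 1 \<in> {0..<1}" "y + 1 \<notin> F"
      using that by (auto simp: U_def F_def F1_def algebra_simps)
    moreover from this have "y + 1 \<notin> inner As" using inner_F by blast
    ultimately have "curve K (y + 1) = curve K' (y + 1)" using curve_outside[of "y + 1"] by simp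
    thus ?thesis using per[OF tw] per[OF tw'] by simp
  qed
  have "eventually (\<lambda>y. curve K y = curve K' y) (nhds x)"
    using U xU eq unfolding eventually_nhds by blast
  thus ?thesis
    unfolding velocity_def by (intro vector_derivative_cong_eq) (auto elim: eventually_mono)
qed

lemma double_points_outside_subset: "double_points K - interior D \<subseteq> double_points K' - interior D"
proof
  fix c assume c: "c \<in> double_points K - interior D"
  then obtain x y where xy: "x \<in> {0..<1}" "y \<in> {0..<1}" "x \<noteq> y" "curve K x = c" "curve K y = c"
    unfolding double_points_def by auto
  hence "x \<notin> inner As" "y \<notin> inner As"
    using c tangle_interior_iff[OF tg xy(1)] tangle_interior_iff[OF tg xy(2)] by auto
  hence "curve K' x = c" "curve K' y = c"
    using xy curve_outside by auto
  thus "c \<in> double_points K' - interior D"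
    using xy c unfolding double_points_def by force
qed

lemma classical_crossings_outside:
  "classical_crossings K - interior D = classical_crossings K' - interior D"
proof -
  have "double_points K - interior D = double_points K' - interior D"
    using double_points_outside_subset replacement.double_points_outside_subset[OF replacement_sym]
    by blast
  moreover have "virtuals K - interior D = virtuals K' - interior D"
    using agree unfolding agree_outside_def by blast
  moreover have "classical_crossings L - interior D =
      (double_points L - interior D) - (virtuals L - interior D)" for L
    by (auto simp: classical_crossings_def)
  ultimately show ?thesis by simp
qed

lemma passages_outside:
  assumes "C - interior D = C' - interior D"
  shows "passages K C - inner As = passages K' C' - inner As"
  using assms curve_outside tangle_interior_iff[OF tg] tangle_interior_iff[OF tg']
  by (auto simp: passages_def)

lemma outside_params:
  assumes "c \<in> classical_crossings K" "c \<notin> interior D"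
  obtains x y where "x \<in> {0..<1}" "y \<in> {0..<1}" "x \<noteq> y" "curve K x = c" "curve K y = c"
    "curve K' x = c" "curve K' y = c" "x \<notin> inner As" "y \<notin> inner As"
    "c \<in> classical_crossings K'" "crossing_sign K c = crossing_sign K' c"
proof -
  obtain x y where xy: "x \<in> {0..<1}" "y \<in> {0..<1}" "x \<noteq> y" "curve K x = c" "curve K y = c"
    "x \<in> overs K" "y \<notin> overs K" "over_param K c = x" "under_param K c = y"
    "passages K {c} = {x, y}"
    by (rule classical_crossing_params[OF tw assms(1)])
  have out: "x \<notin> inner As" "y \<notin> inner As"
    using xy(4,5) assms(2) tangle_interior_iff[OF tg xy(1)] tangle_interior_iff[OF tg xy(2)]
    by auto
  hence crv: "curve K' x = c" "curve K' y = c"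
    using xy(4,5) curve_outside[OF xy(1) out(1)] curve_outside[OF xy(2) out(2)] by auto
  have c': "c \<in> classical_crossings K'"
    using classical_crossings_outside assms by auto
  have "overs K - inner As = overs K' - inner As"
    using agree unfolding agree_outside_def by blast
  hence "x \<in> overs K'" "y \<notin> overs K'" using xy(6,7) out by auto
  hence "over_param K' c = x" "under_param K' c = y"
    using over_param_eqI[OF tw' xy(1) crv(1) c'] under_param_eqI[OF tw' xy(2) crv(2) c'] by auto
  moreover have "x \<notin> ends As" "y \<notin> ends As"
    using double_point_not_end[OF tg xy(1-3)] double_point_not_end[OF tg xy(2,1)] xy(3-5) by auto
  ultimately have "crossing_sign K c = crossing_sign K' c"
    using xy out velocity_outside by (simp add: crossing_sign_def turn_def)
  thus ?thesis by (rule that[OF xy(1-5) crv out c'])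
qed

lemmas finite_classical_passages =
  finite_passages[OF tw order_refl] finite_passages[OF tw' order_refl]
lemmas finite_zero_passages =
  finite_passages[OF tw zero_crossings_subset] finite_passages[OF tw' zero_crossings_subset]

text \<open>Being a zero crossing depends on classical passages alone. This is what makes the outer
  passages through zero crossings comparable at all.\<close>

lemma zero_crossings_outside:
  assumes "parity_agree As (passages K (classical_crossings K)) (passages K' (classical_crossings K'))"
  shows "zero_crossings K - interior D = zero_crossings K' - interior D"
proof -
  have "c \<in> zero_crossings K \<longleftrightarrow> c \<in> zero_crossings K'"
    if c: "c \<in> classical_crossings K" "c \<notin> interior D" for c
  proof -
    obtain x y where xy: "x \<in> {0..<1}" "y \<in> {0..<1}" "x \<noteq> y" "curve K x = c" "curve K y = c"
      "curve K' x = c" "curve K' y = c" "x \<notin> inner As" "y \<notin> inner As" "c \<in> classical_crossings K'"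
      "crossing_sign K c = crossing_sign K' c"
      by (rule outside_params[OF c])
    show ?thesis
      using zero_crossing_iff[OF tw c(1) xy(1-5)] zero_crossing_iff[OF tw' xy(10) xy(1-3,6,7)]
        even_count_below_outside[OF tg assms finite_classical_passages xy(8)]
        even_count_below_outside[OF tg assms finite_classical_passages xy(9)]
      by simp
  qed
  thus ?thesis
    using classical_crossings_outside zero_crossings_subset[of K] zero_crossings_subset[of K']
    by (auto simp: set_eq_iff)
qed

lemma crossing_term_outside:
  assumes ag: "parity_agree As (passages K (classical_crossings K)) (passages K' (classical_crossings K'))"
      "parity_agree As (passages K (zero_crossings K)) (passages K' (zero_crossings K'))"
      "parity_agree As (bars K) (bars K')"
    and c: "c \<in> classical_crossings K" "c \<notin> interior D"
  shows "crossing_term K c = crossing_term K' c"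
proof -
  obtain x y where xy: "x \<in> {0..<1}" "y \<in> {0..<1}" "x \<noteq> y" "curve K x = c" "curve K y = c"
    "curve K' x = c" "curve K' y = c" "x \<notin> inner As" "y \<notin> inner As" "c \<in> classical_crossings K'"
    "crossing_sign K c = crossing_sign K' c"
    by (rule outside_params[OF c])
  have zero: "c \<in> zero_crossings K \<longleftrightarrow> c \<in> zero_crossings K'"
    using zero_crossings_outside[OF ag(1)] c(2) by blast
  have "s_exponent K c = s_exponent K' c"
    unfolding s_exponent_def
    using zero z_parity_eq[OF tw _ xy(1-5)] z_parity_eq[OF tw' _ xy(1-3,6,7)]
      even_count_below_outside[OF tg ag(2) finite_zero_passages xy(8)]
      even_count_below_outside[OF tg ag(2) finite_zero_passages xy(9)]
    by simp
  moreover have fb: "finite (bars K)" "finite (bars K')"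
    using bars_facts tw tw' by auto
  ultimately show ?thesis
    unfolding crossing_term_eq[OF tw c(1) xy(1-5)] crossing_term_eq[OF tw' xy(10) xy(1-3,6,7)] xy(11)
    using even_count_below_outside[OF tg ag(3) fb xy(8)]
      even_count_below_outside[OF tg ag(3) fb xy(9)] even_card_agree[OF tg ag(3) fb]
    by (intro arg_cong2[where f = "(*)"] crossing_weight_cong) (auto simp: even_add)
qed

text \<open>The frame for every move: once the three sets of marks agree modulo 2 on each strand,
  the outer terms coincide and only the sums inside the disc are left.\<close>

lemma Qz_eqI:
  assumes "parity_agree As (passages K (classical_crossings K)) (passages K' (classical_crossings K'))"
      "parity_agree As (passages K (zero_crossings K)) (passages K' (zero_crossings K'))"
      "parity_agree As (bars K) (bars K')"
    and inside: "(\<Sum>c\<in>classical_crossings K \<inter> interior D. crossing_term K c) =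
      (\<Sum>c\<in>classical_crossings K' \<inter> interior D. crossing_term K' c)"
  shows "Qz K = Qz K'"
proof -
  have split: "Qz L = (\<Sum>c\<in>classical_crossings L \<inter> interior D. crossing_term L c)
      + (\<Sum>c\<in>classical_crossings L - interior D. crossing_term L c)"
    if "twisted_knot_diagram L" for L
    unfolding Qz_eq_sum[OF that]
    by (rule sum.Int_Diff[OF finite_classical_crossings[OF that]])
  have "(\<Sum>c\<in>classical_crossings K - interior D. crossing_term K c) =
      (\<Sum>c\<in>classical_crossings K' - interior D. crossing_term K' c)"
    unfolding classical_crossings_outside[symmetric]
    using crossing_term_outside[OF assms(1-3)] by (intro sum.cong) auto
  thus ?thesis unfolding split[OF tw] split[OF tw'] inside by simp
qed

lemma parity_agree_classicalI:
  assumes "\<And>A. A \<in> set As \<Longrightarrow> even (card (passages K (classical_crossings K) \<inter> interval A)) =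
      even (card (passages K' (classical_crossings K') \<inter> interval A))"
  shows "parity_agree As (passages K (classical_crossings K)) (passages K' (classical_crossings K'))"
  unfolding parity_agree_def using passages_outside[OF classical_crossings_outside] assms by blast

lemma parity_agree_zeroI:
  assumes "parity_agree As (passages K (classical_crossings K)) (passages K' (classical_crossings K'))"
    "\<And>A. A \<in> set As \<Longrightarrow> even (card (passages K (zero_crossings K) \<inter> interval A)) =
      even (card (passages K' (zero_crossings K') \<inter> interval A))"
  shows "parity_agree As (passages K (zero_crossings K)) (passages K' (zero_crossings K'))"
  unfolding parity_agree_def
  using passages_outside[OF zero_crossings_outside[OF assms(1)]] assms(2) by blast

lemma parity_agree_barsI:
  assumes "\<And>A. A \<in> set As \<Longrightarrow>
      even (card (bars K \<inter> interval A)) = even (card (bars K' \<inter> interval A))"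
  shows "parity_agree As (bars K) (bars K')"
  using assms agree unfolding parity_agree_def agree_outside_def by blast

lemma parity_agree_no_bars:
  assumes "bars_in As K = {}" "bars_in As K' = {}"
  shows "parity_agree As (bars K) (bars K')"
proof (rule parity_agree_barsI)
  fix A assume "A \<in> set As"
  hence "bars K \<inter> interval A = {}" "bars K' \<inter> interval A = {}"
    using assms by (auto simp: bars_in_def inner_def)
  thus "even (card (bars K \<inter> interval A)) = even (card (bars K' \<inter> interval A))" by simp
qed

text \<open>Local counts of zero passages are compared only if the crossing is a zero crossing,
  since otherwise the exponent of \<open>s_var\<close> is 1 anyway. The restriction matters: in a
  triangle this comparison fails at crossings that are not zero crossings.\<close>

lemma crossing_term_inside:
  assumes AB: "A \<in> set As" "B \<in> set As" "A \<noteq> B"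
    and cr: "cross_at K A B x y" "cross_at K' A B x' y'"
    and cc: "curve K x \<in> classical_crossings K" "curve K' x' \<in> classical_crossings K'"
    and bars: "parity_agree As (bars K) (bars K')"
      "even (local_count (bars K) A x + local_count (bars K) B y) =
       even (local_count (bars K') A x' + local_count (bars K') B y')"
    and sgn: "crossing_sign K (curve K x) = crossing_sign K' (curve K' x')"
    and zero: "curve K x \<in> zero_crossings K \<longleftrightarrow> curve K' x' \<in> zero_crossings K'"
    and Z: "parity_agree As (passages K (zero_crossings K)) (passages K' (zero_crossings K'))"
      "curve K x \<in> zero_crossings K \<Longrightarrow>
       even (local_count (passages K (zero_crossings K)) A x
           + local_count (passages K (zero_crossings K)) B y) =
       even (local_count (passages K' (zero_crossings K')) A x'
           + local_count (passages K' (zero_crossings K')) B y')"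
  shows "crossing_term K (curve K x) = crossing_term K' (curve K' x')"
proof -
  note f = cross_at_facts[OF tw tg AB cr(1)] and f' = cross_at_facts[OF tw' tg' AB cr(2)]
  have fb: "finite (bars K)" "finite (bars K')"
    using bars_facts tw tw' by auto
  have "s_exponent K (curve K x) = s_exponent K' (curve K' x')"
    unfolding s_exponent_def
    using zero z_parity_eq[OF tw _ f(1-3) refl f(6)] z_parity_eq[OF tw' _ f'(1-3) refl f'(6)]
      even_count_below_inside[OF tg Z(1) finite_zero_passages AB(1,2) f(4,5) f'(4,5) Z(2)]
    by auto
  thus ?thesis
    unfolding crossing_term_eq[OF tw cc(1) f(1-3) refl f(6)]
      crossing_term_eq[OF tw' cc(2) f'(1-3) refl f'(6)] sgn
    using even_count_below_inside[OF tg bars(1) fb AB(1,2) f(4,5) f'(4,5) bars(2)]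
      even_card_agree[OF tg bars(1) fb]
    by (intro arg_cong2[where f = "(*)"] crossing_weight_cong) auto
qed

lemma zero_crossing_inside_iff:
  assumes AB: "A \<in> set As" "B \<in> set As" "A \<noteq> B"
    and cr: "cross_at K A B x y" "cross_at K' A B x' y'"
    and cc: "curve K x \<in> classical_crossings K" "curve K' x' \<in> classical_crossings K'"
    and X: "parity_agree As (passages K (classical_crossings K)) (passages K' (classical_crossings K'))"
      "even (local_count (passages K (classical_crossings K)) A x
           + local_count (passages K (classical_crossings K)) B y) =
       even (local_count (passages K' (classical_crossings K')) A x'
           + local_count (passages K' (classical_crossings K')) B y')"
  shows "curve K x \<in> zero_crossings K \<longleftrightarrow> curve K' x' \<in> zero_crossings K'"
proof -
  note f = cross_at_facts[OF tw tg AB cr(1)] and f' = cross_at_facts[OF tw' tg' AB cr(2)]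
  show ?thesis
    using zero_crossing_iff[OF tw cc(1) f(1-3) refl f(6)]
      zero_crossing_iff[OF tw' cc(2) f'(1-3) refl f'(6)]
      even_count_below_inside[OF tg X(1) finite_classical_passages AB(1,2) f(4,5) f'(4,5) X(2)]
    by blast
qed

end

section \<open>The local moves\<close>

lemma tangle_distinct:
  assumes "tangle_in_disc D As K"
  shows "distinct As"
  unfolding distinct_conv_nth
proof (intro allI impI)
  fix i j assume ij: "i < length As" "j < length As" "i \<noteq> j"
  have "{fst (As ! i)..snd (As ! i)} \<inter> {fst (As ! j)..snd (As ! j)} = {}"
    using assms ij unfolding tangle_in_disc_def by blast
  thus "As ! i \<noteq> As ! j"
    using tangle_strand_bounds(2)[OF assms nth_mem[OF ij(1)]] by auto
qed

lemma bars_inD: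
  assumes "bars_in As K = {}" "A \<in> set As"
  shows "bars K \<inter> interval A = {}" "local_count (bars K) A x = 0"
proof -
  show *: "bars K \<inter> interval A = {}"
    using assms by (auto simp: bars_in_def inner_def)
  show "local_count (bars K) A x = 0"
    unfolding local_count_def * by simp
qed

lemma crossing_signI:
  assumes tw: "twisted_knot_diagram K" and tg: "tangle_in_disc D As K"
    and AB: "A \<in> set As" "B \<in> set As" "A \<noteq> B" and cr: "cross_at K A B x y"
    and cc: "curve K x \<in> classical_crossings K" and ov: "x \<in> overs K"
  shows "crossing_sign K (curve K x) = turn K x y"
proof -
  note f = cross_at_facts[OF tw tg AB cr]
  have "y \<notin> overs K"
    using overs_iff[OF tw f(1-3) f(6)[symmetric] cc] ov by simp
  hence "over_param K (curve K x) = x" "under_param K (curve K x) = y"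
    using over_param_eqI[OF tw f(1) refl cc ov] under_param_eqI[OF tw f(2,6) cc] by auto
  thus ?thesis by (simp add: crossing_sign_def)
qed

text \<open>In the absence of triple points, a parameter over the crossing is one of its two
  passages, and each of these lies on one strand only.\<close>

lemma cross_at_strand:
  assumes tw: "twisted_knot_diagram K" and tg: "tangle_in_disc D As K"
    and AB: "A \<in> set As" "B \<in> set As" "A \<noteq> B" and cr: "cross_at K A B x y"
    and C: "C \<in> set As" and w: "w \<in> interval C" "curve K w = curve K x"
  shows "(C = A \<and> w = x) \<or> (C = B \<and> w = y)"
proof -
  note f = cross_at_facts[OF tw tg AB cr]
  have "w \<in> {0..<1}" using interval_unit[OF tg C] w(1) by auto
  hence "w \<in> passages K {curve K x}" using w(2) by (simp add: passages_def)
  hence "w = x \<or> w = y" using f(9) by simp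
  moreover have "interval C \<inter> interval A = {}" if "C \<noteq> A"
    using tangle_intervals_disjoint[OF tg C AB(1) that] .
  moreover have "interval C \<inter> interval B = {}" if "C \<noteq> B"
    using tangle_intervals_disjoint[OF tg C AB(2) that] .
  ultimately show ?thesis using w(1) f(4,5) by blast
qed

lemma classical_crossings_inside:
  "classical_crossings K \<inter> interior D = double_points_in D K - virtuals K"
  by (auto simp: classical_crossings_def double_points_in_def)

section \<open>Discs without triangles: at most one crossing, or a bigon\<close>

context replacement
begin

text \<open>Covers V1, V2, V3, T1 and T2: virtual crossings are never counted, so the bars are the
  only marks left in the disc.\<close>

lemma no_classical_inside:
  assumes I: "classical_crossings K \<inter> interior D = {}" "classical_crossings K' \<inter> interior D = {}"
    and bars: "parity_agree As (bars K) (bars K')"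
  shows "Qz K = Qz K'"
proof -
  have I0: "zero_crossings K \<inter> interior D = {}" "zero_crossings K' \<inter> interior D = {}"
    using I zero_crossings_subset by blast+
  have X: "parity_agree As (passages K (classical_crossings K))
      (passages K' (classical_crossings K'))"
    by (rule parity_agree_classicalI)
      (simp add: passages_Int_interval[OF tg] passages_Int_interval[OF tg'] I)
  have Z: "parity_agree As (passages K (zero_crossings K)) (passages K' (zero_crossings K'))"
    by (rule parity_agree_zeroI[OF X])
      (simp add: passages_Int_interval[OF tg] passages_Int_interval[OF tg'] I0)
  show ?thesis by (rule Qz_eqI[OF X Z bars]) (simp add: I)
qed

text \<open>Covers V4 and T3. The single classical crossing is the only counted passage on each of
  its two strands and is not below itself, so all local counts of passages vanish and only its sign
  and the bars have to be compared.\<close>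

lemma one_classical_inside:
  assumes AB: "A \<in> set As" "B \<in> set As" "A \<noteq> B"
    and cr: "cross_at K A B x y" "cross_at K' A B x' y'"
    and I: "classical_crossings K \<inter> interior D = {curve K x}"
      "classical_crossings K' \<inter> interior D = {curve K' x'}"
    and sgn: "crossing_sign K (curve K x) = crossing_sign K' (curve K' x')"
    and bars: "parity_agree As (bars K) (bars K')"
      "even (local_count (bars K) A x + local_count (bars K) B y) =
       even (local_count (bars K') A x' + local_count (bars K') B y')"
  shows "Qz K = Qz K'"
proof -
  let ?c = "curve K x" and ?c' = "curve K' x'"
  have cc: "?c \<in> classical_crossings K" "?c' \<in> classical_crossings K'" using I by auto
  have pass: "passages L C \<inter> interval E = (if curve L u \<in> C then
      (if E = A then {u} else if E = B then {v} else {}) else {})"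
    if "twisted_knot_diagram L" "tangle_in_disc D As L" "cross_at L A B u v"
      "C \<inter> interior D \<subseteq> {curve L u}" "E \<in> set As" for L C E u v
  proof -
    note f = cross_at_facts[OF that(1,2) AB that(3)]
    have "w \<in> interval E \<and> curve L w \<in> C \<inter> interior D \<longleftrightarrow>
        curve L u \<in> C \<and> ((E = A \<and> w = u) \<or> (E = B \<and> w = v))" for w
    proof
      assume w: "w \<in> interval E \<and> curve L w \<in> C \<inter> interior D"
      hence "curve L w = curve L u" using that(4) by auto
      thus "curve L u \<in> C \<and> ((E = A \<and> w = u) \<or> (E = B \<and> w = v))"
        using cross_at_strand[OF that(1,2) AB that(3,5), of w] w by auto
    qed (use f in auto)
    thus ?thesis
      unfolding passages_Int_interval[OF that(2,5)] using AB(3) by (auto simp: set_eq_iff)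
  qed
  have X: "parity_agree As (passages K (classical_crossings K))
      (passages K' (classical_crossings K'))"
    by (rule parity_agree_classicalI)
      (simp add: pass[OF tw tg cr(1)] pass[OF tw' tg' cr(2)] I cc)
  have lc: "local_count (passages K C) A x = 0" "local_count (passages K C) B y = 0"
    if "C \<subseteq> classical_crossings K" for C
  proof -
    have "C \<inter> interior D \<subseteq> {?c}" using that I(1) by auto
    note p = pass[OF tw tg cr(1) this AB(1)] pass[OF tw tg cr(1) this AB(2)]
    show "local_count (passages K C) A x = 0" "local_count (passages K C) B y = 0"
      unfolding local_count_def p using AB(3) by auto
  qed
  have lc': "local_count (passages K' C) A x' = 0" "local_count (passages K' C) B y' = 0"
    if "C \<subseteq> classical_crossings K'" for C
  proof -
    have "C \<inter> interior D \<subseteq> {?c'}" using that I(2) by auto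
    note p = pass[OF tw' tg' cr(2) this AB(1)] pass[OF tw' tg' cr(2) this AB(2)]
    show "local_count (passages K' C) A x' = 0" "local_count (passages K' C) B y' = 0"
      unfolding local_count_def p using AB(3) by auto
  qed
  have zero: "?c \<in> zero_crossings K \<longleftrightarrow> ?c' \<in> zero_crossings K'"
    by (rule zero_crossing_inside_iff[OF AB cr cc X]) (simp add: lc lc')
  have I0: "zero_crossings K \<inter> interior D \<subseteq> {?c}" "zero_crossings K' \<inter> interior D \<subseteq> {?c'}"
    using I zero_crossings_subset by blast+
  have Z: "parity_agree As (passages K (zero_crossings K)) (passages K' (zero_crossings K'))"
    by (rule parity_agree_zeroI[OF X])
      (simp add: pass[OF tw tg cr(1) I0(1)] pass[OF tw' tg' cr(2) I0(2)] zero)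
  have "crossing_term K ?c = crossing_term K' ?c'"
    by (rule crossing_term_inside[OF AB cr cc bars sgn zero Z])
      (simp add: lc lc' zero_crossings_subset)
  thus ?thesis by (intro Qz_eqI[OF X Z bars(1)]) (simp add: I)
qed

text \<open>The loop between the two passages carries no counted passage and no bar. So one
  component has even index, the crossing is a zero crossing, its exponent of \<open>s_var\<close> is
  0 and one bar parity is 0: the corresponding factor is \<open>1 - 1\<close>.\<close>

lemma kink:
  assumes As: "As = [A]" and bars: "bars_in As K = {}" "bars_in As K' = {}"
    and I: "double_points_in D K = {}" "double_points_in D K' = {c}" "c \<notin> virtuals K'"
  shows "Qz K = Qz K'"
proof -
  have cI: "classical_crossings K \<inter> interior D = {}"
    "classical_crossings K' \<inter> interior D = {c}"
    unfolding classical_crossings_inside using I by auto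
  have cc: "c \<in> classical_crossings K'" "c \<in> interior D" using cI by auto
  obtain x y where xy0: "x \<in> {0..<1}" "y \<in> {0..<1}" "x \<noteq> y" "curve K' x = c" "curve K' y = c"
    "passages K' {c} = {x, y}"
    using classical_crossing_params[OF tw' cc(1)] by metis
  \<comment> \<open>The passages are named by their order along the strand and not by over and
    under; the parity formulas are symmetric in them.\<close>
  define a where "a = min x y"
  define b where "b = max x y"
  have ab: "a \<in> {0..<1}" "b \<in> {0..<1}" "a \<noteq> b" "curve K' a = c" "curve K' b = c"
    "passages K' {c} = {a, b}" "a < b"
    using xy0 by (auto simp: a_def b_def min_def max_def)
  have inA: "a \<in> interval A" "b \<in> interval A"
    using tangle_interior_iff[OF tg' ab(1)] tangle_interior_iff[OF tg' ab(2)] ab(4,5) cc(2)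
    by (auto simp: As inner_def)
  have A: "A \<in> set As" by (simp add: As)
  have pass: "passages K' C \<inter> interval A = (if c \<in> C then {a, b} else {})"
    if "C \<subseteq> classical_crossings K'" for C
  proof -
    have "C \<inter> interior D = (if c \<in> C then {c} else {})"
      using that cI(2) by auto
    hence "{w\<in>interval A. curve K' w \<in> C \<inter> interior D} =
        (if c \<in> C then passages K' {c} \<inter> interval A else {})"
      using interval_unit[OF tg' A] by (auto simp: passages_def)
    moreover have "{a, b} \<inter> interval A = {a, b}" using inA by auto
    ultimately show ?thesis
      unfolding passages_Int_interval[OF tg' A] ab(6) by simp
  qed
  have none: "passages K C \<inter> interval A = {}" if "C \<subseteq> classical_crossings K" for C
    using that cI(1) unfolding passages_Int_interval[OF tg A] by auto
  have X: "parity_agree As (passages K (classical_crossings K))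
      (passages K' (classical_crossings K'))"
    by (rule parity_agree_classicalI) (simp add: As none pass cc ab(3))
  have Z: "parity_agree As (passages K (zero_crossings K)) (passages K' (zero_crossings K'))"
    by (rule parity_agree_zeroI[OF X]) (simp add: As none pass zero_crossings_subset ab(3))
  note B = parity_agree_no_bars[OF bars]
  have count: "count_below (passages K' C) b = count_below (passages K' C) a + of_bool (c \<in> C)"
    if "C \<subseteq> classical_crossings K'" for C
  proof -
    have "passages K' C \<inter> interval A \<inter> {..<a} = {}"
      "passages K' C \<inter> interval A \<inter> {..<b} = (if c \<in> C then {a} else {})"
      unfolding pass[OF that] using ab(7) by auto
    thus ?thesis
      using count_below_inside[OF finite_passages[OF tw' that] inA(1)]
        count_below_inside[OF finite_passages[OF tw' that] inA(2)]
      by (simp add: local_count_def)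
  qed
  have zero: "c \<in> zero_crossings K'"
    using zero_crossing_iff[OF tw' cc(1) ab(1-5)] count[OF order_refl] cc(1) by simp
  have "z_parity K' c = 0"
    using z_parity_eq[OF tw' zero ab(1-5)] count[OF zero_crossings_subset] zero by simp
  hence "s_exponent K' c = 0" by (simp add: s_exponent_def zero)
  moreover have "even (count_below (bars K') a + count_below (bars K') b)"
    using count_below_inside[OF bars_facts(1)[OF tw'] inA(1)]
      count_below_inside[OF bars_facts(1)[OF tw'] inA(2)] bars_inD[OF bars(2) A]
    by simp
  ultimately have "crossing_term K' c = 0"
    unfolding crossing_term_eq[OF tw' cc(1) ab(1-5)]
    by (simp add: crossing_weight_def even_iff_mod_2_eq_zero)
  thus ?thesis by (intro Qz_eqI[OF X Z B]) (simp add: cI)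
qed

text \<open>The argument covers parallel and antiparallel strands at once. Equal parities at both
  crossings make both or neither zero crossings, so each strand gains zero or two zero passages and
  the outside notices nothing. The signs are opposite because \<open>A\<close> is over at both
  crossings while the directions of crossing differ.\<close>

lemma bigon_move:
  assumes As: "As = [A, B]" and bars: "bars_in As K = {}" "bars_in As K' = {}"
    and I: "double_points_in D K = {}" and big: "bigon D K' A B x1 y1 x2 y2"
    and ov: "x1 \<in> overs K'" "x2 \<in> overs K'" and vir: "virtuals K' \<inter> interior D = {}"
  shows "Qz K = Qz K'"
proof -
  have A: "A \<in> set As" and B: "B \<in> set As" by (simp_all add: As)
  have AB: "A \<noteq> B"
    using tangle_distinct[OF tg] by (simp add: As)
  have cr: "cross_at K' A B x1 y1" "cross_at K' A B x2 y2" and x12: "x1 \<noteq> x2"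
    and dp: "double_points_in D K' = {curve K' x1, curve K' x2}"
    and trn: "turn K' x1 y1 = - turn K' x2 y2"
    using big unfolding bigon_def by auto
  let ?c1 = "curve K' x1" and ?c2 = "curve K' x2"
  note f1 = cross_at_facts[OF tw' tg' A B AB cr(1)] and f2 = cross_at_facts[OF tw' tg' A B AB cr(2)]
  note st1 = cross_at_strand[OF tw' tg' A B AB cr(1)] and st2 = cross_at_strand[OF tw' tg' A B AB cr(2)]
  have c12: "?c1 \<noteq> ?c2"
    using st1[OF A f2(4)] x12 AB by auto
  have y12: "y1 \<noteq> y2" using c12 f1(6) f2(6) by auto
  have cI: "classical_crossings K \<inter> interior D = {}"
    "classical_crossings K' \<inter> interior D = {?c1, ?c2}"
    unfolding classical_crossings_inside I dp using f1(8) f2(8) vir by auto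
  have cc: "?c1 \<in> classical_crossings K'" "?c2 \<in> classical_crossings K'" using cI by auto
  have pass: "passages K' C \<inter> interval A = {w\<in>{x1, x2}. curve K' w \<in> C}"
    "passages K' C \<inter> interval B = {w\<in>{y1, y2}. curve K' w \<in> C}"
    if "C \<subseteq> classical_crossings K'" for C
  proof -
    have in12: "curve K' w = ?c1 \<or> curve K' w = ?c2" if "curve K' w \<in> C \<inter> interior D" for w
      using that \<open>C \<subseteq> classical_crossings K'\<close> cI(2) by auto
    show "passages K' C \<inter> interval A = {w\<in>{x1, x2}. curve K' w \<in> C}"
      unfolding passages_Int_interval[OF tg' A]
    proof (intro Collect_cong iffI; elim conjE)
      fix w assume w: "w \<in> interval A" "curve K' w \<in> C \<inter> interior D"
      show "w \<in> {x1, x2} \<and> curve K' w \<in> C"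
        using in12[OF w(2)] st1[OF A w(1)] st2[OF A w(1)] AB w(2) by auto
    next
      fix w assume w: "w \<in> {x1, x2}" "curve K' w \<in> C"
      thus "w \<in> interval A \<and> curve K' w \<in> C \<inter> interior D"
        using f1(4,8) f2(4,8) by auto
    qed
    show "passages K' C \<inter> interval B = {w\<in>{y1, y2}. curve K' w \<in> C}"
      unfolding passages_Int_interval[OF tg' B]
    proof (intro Collect_cong iffI; elim conjE)
      fix w assume w: "w \<in> interval B" "curve K' w \<in> C \<inter> interior D"
      show "w \<in> {y1, y2} \<and> curve K' w \<in> C"
        using in12[OF w(2)] st1[OF B w(1)] st2[OF B w(1)] AB w(2) by auto
    next
      fix w assume w: "w \<in> {y1, y2}" "curve K' w \<in> C"
      thus "w \<in> interval B \<and> curve K' w \<in> C \<inter> interior D"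
        using f1(5,6,8) f2(5,6,8) by auto
    qed
  qed
  have none: "passages K C \<inter> interval E = {}"
    if "C \<subseteq> classical_crossings K" "E \<in> set As" for C E
    using that(1) cI(1) unfolding passages_Int_interval[OF tg that(2)] by auto
  have lc: "local_count (passages K' C) A x1 = of_bool (?c2 \<in> C \<and> x2 < x1)"
    "local_count (passages K' C) A x2 = of_bool (?c1 \<in> C \<and> x1 < x2)"
    "local_count (passages K' C) B y1 = of_bool (?c2 \<in> C \<and> y2 < y1)"
    "local_count (passages K' C) B y2 = of_bool (?c1 \<in> C \<and> y1 < y2)"
    if "C \<subseteq> classical_crossings K'" for C
  proof -
    have card: "card ({w\<in>{p, q}. P w} \<inter> {..<p}) = of_bool (P q \<and> q < p)"
      "card ({w\<in>{p, q}. P w} \<inter> {..<q}) = of_bool (P p \<and> p < q)" for p q :: real and P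
    proof -
      have "{w\<in>{p, q}. P w} \<inter> {..<p} = (if P q \<and> q < p then {q} else {})"
        "{w\<in>{p, q}. P w} \<inter> {..<q} = (if P p \<and> p < q then {p} else {})"
        by auto
      thus "card ({w\<in>{p, q}. P w} \<inter> {..<p}) = of_bool (P q \<and> q < p)"
        "card ({w\<in>{p, q}. P w} \<inter> {..<q}) = of_bool (P p \<and> p < q)"
        by auto
    qed
    show "local_count (passages K' C) A x1 = of_bool (?c2 \<in> C \<and> x2 < x1)"
      "local_count (passages K' C) A x2 = of_bool (?c1 \<in> C \<and> x1 < x2)"
      "local_count (passages K' C) B y1 = of_bool (?c2 \<in> C \<and> y2 < y1)"
      "local_count (passages K' C) B y2 = of_bool (?c1 \<in> C \<and> y1 < y2)"
      unfolding local_count_def pass[OF that] card f1(6) f2(6) by (rule refl)+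
  qed
  \<comment> \<open>Going from the first crossing to the second shifts the local count by one on
    \<open>A\<close> and by one on \<open>B\<close>, up or down, if the crossings belong to
    \<open>C\<close>; the two shifts cancel modulo 2.\<close>
  have cnt: "even (count_below (passages K' C) x1 + count_below (passages K' C) y1) =
      even (count_below (passages K' C) x2 + count_below (passages K' C) y2)"
    if "C \<subseteq> classical_crossings K'" "?c1 \<in> C \<longleftrightarrow> ?c2 \<in> C" for C
    using count_below_inside[OF finite_passages[OF tw' that(1)] f1(4)]
      count_below_inside[OF finite_passages[OF tw' that(1)] f1(5)]
      count_below_inside[OF finite_passages[OF tw' that(1)] f2(4)]
      count_below_inside[OF finite_passages[OF tw' that(1)] f2(5)] x12 y12 that(2)
    unfolding lc[OF that(1)] by (auto simp: even_add)
  have zero: "?c1 \<in> zero_crossings K' \<longleftrightarrow> ?c2 \<in> zero_crossings K'"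
    using zero_crossing_iff[OF tw' cc(1) f1(1-3) refl f1(6)]
      zero_crossing_iff[OF tw' cc(2) f2(1-3) refl f2(6)] cnt[OF order_refl] cc by blast
  have card2: "even (card {w\<in>{p, q}. curve K' w \<in> C})"
    if "p \<noteq> q" "curve K' p \<in> C \<longleftrightarrow> curve K' q \<in> C" for p q and C :: "complex set"
  proof -
    have "{w\<in>{p, q}. curve K' w \<in> C} = (if curve K' p \<in> C then {p, q} else {})"
      using that(2) by auto
    thus ?thesis using that(1) by simp
  qed
  have X: "parity_agree As (passages K (classical_crossings K))
      (passages K' (classical_crossings K'))"
  proof (rule parity_agree_classicalI)
    fix E assume E: "E \<in> set As"
    hence "E = A \<or> E = B" by (simp add: As)
    hence "even (card (passages K' (classical_crossings K') \<inter> interval E))"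
      using pass[OF order_refl] card2[OF x12] card2[OF y12] cc f1(6) f2(6) by auto
    thus "even (card (passages K (classical_crossings K) \<inter> interval E)) =
      even (card (passages K' (classical_crossings K') \<inter> interval E))"
      using none[OF order_refl E] by simp
  qed
  have Z: "parity_agree As (passages K (zero_crossings K)) (passages K' (zero_crossings K'))"
  proof (rule parity_agree_zeroI[OF X])
    fix E assume E: "E \<in> set As"
    hence "E = A \<or> E = B" by (simp add: As)
    hence "even (card (passages K' (zero_crossings K') \<inter> interval E))"
      using pass[OF zero_crossings_subset] card2[OF x12] card2[OF y12] zero f1(6) f2(6) by auto
    thus "even (card (passages K (zero_crossings K) \<inter> interval E)) =
      even (card (passages K' (zero_crossings K') \<inter> interval E))"
      using none[OF zero_crossings_subset E] by simp
  qed
  note Bs = parity_agree_no_bars[OF bars]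
  have s: "s_exponent K' ?c1 = s_exponent K' ?c2"
    unfolding s_exponent_def
    using zero z_parity_eq[OF tw' _ f1(1-3) refl f1(6)] z_parity_eq[OF tw' _ f2(1-3) refl f2(6)]
      cnt[OF zero_crossings_subset zero] by auto
  have b: "even (count_below (bars K') x1 + count_below (bars K') y1) =
      even (count_below (bars K') x2 + count_below (bars K') y2)"
    using count_below_inside[OF bars_facts(1)[OF tw'] f1(4)]
      count_below_inside[OF bars_facts(1)[OF tw'] f1(5)]
      count_below_inside[OF bars_facts(1)[OF tw'] f2(4)]
      count_below_inside[OF bars_facts(1)[OF tw'] f2(5)]
      bars_inD[OF bars(2) A] bars_inD[OF bars(2) B] by simp
  have "crossing_sign K' ?c1 = - crossing_sign K' ?c2"
    using trn crossing_signI[OF tw' tg' A B AB cr(1) cc(1) ov(1)]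
      crossing_signI[OF tw' tg' A B AB cr(2) cc(2) ov(2)] by simp
  hence "crossing_term K' ?c1 = - crossing_term K' ?c2"
    unfolding crossing_term_eq[OF tw' cc(1) f1(1-3) refl f1(6)]
      crossing_term_eq[OF tw' cc(2) f2(1-3) refl f2(6)]
    using crossing_weight_cong[OF s b refl] by simp
  thus ?thesis by (intro Qz_eqI[OF X Z Bs]) (simp add: cI c12)
qed

end

section \<open>Triangles\<close>

lemma cross_at_commute: "cross_at K A B x y \<longleftrightarrow> cross_at K B A y x"
  by (auto simp: cross_at_def)

text \<open>\<open>crosses_once\<close> asserts uniqueness only for the parameter on
  \<open>A\<close>. The parameter on \<open>B\<close> is then unique as well, because a point has at
  most one passage on each of two distinct strands that cross there; so \<open>meet K B A\<close> is
  well defined too.\<close>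

lemma crosses_once_meet:
  assumes tw: "twisted_knot_diagram K" and tg: "tangle_in_disc D As K"
    and AB: "A \<in> set As" "B \<in> set As" "A \<noteq> B" and once: "crosses_once K A B"
  shows "cross_at K A B (meet K A B) (meet K B A)"
proof -
  obtain x y where xy: "cross_at K A B x y" and uniq: "\<And>x' y'. cross_at K A B x' y' \<Longrightarrow> x' = x"
    using once unfolding crosses_once_def by blast
  have y: "y' = y" if "cross_at K A B x' y'" for x' y'
  proof -
    have "y' \<in> interval B" "curve K y' = curve K x"
      using that uniq[OF that] by (simp_all add: cross_at_def)
    thus ?thesis using cross_at_strand[OF tw tg AB xy AB(2), of y'] AB(3) by blast
  qed
  have "meet K A B = x"
    unfolding meet_def by (rule the_equality) (use xy uniq in blast)+
  moreover have "meet K B A = y"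
    unfolding meet_def cross_at_commute[of K B A] by (rule the_equality) (use xy y in blast)+
  ultimately show ?thesis using xy by simp
qed

text \<open>Formulated for one strand and its two partners, so that permuting the roles yields all
  three sides of a triangle. The crossing of \<open>B\<close> with \<open>E\<close> enters only in
  order to be excluded from \<open>A\<close>.\<close>

lemma two_crossings_on_strand:
  assumes tw: "twisted_knot_diagram K" and tg: "tangle_in_disc D As K"
    and ABE: "A \<in> set As" "B \<in> set As" "E \<in> set As" "A \<noteq> B" "A \<noteq> E" "B \<noteq> E"
    and cr: "cross_at K A B p q" "cross_at K A E r s" "cross_at K B E u v"
    and C: "C \<inter> interior D \<subseteq> {curve K p, curve K r, curve K u}"
  shows "p \<noteq> r" "curve K p \<noteq> curve K r"
    "local_count (passages K C) A p = of_bool (curve K r \<in> C \<and> r < p)"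
    "local_count (passages K C) A r = of_bool (curve K p \<in> C \<and> p < r)"
    "card (passages K C \<inter> interval A) = of_bool (curve K p \<in> C) + of_bool (curve K r \<in> C)"
proof -
  note f1 = cross_at_facts[OF tw tg ABE(1,2,4) cr(1)] and f2 = cross_at_facts[OF tw tg ABE(1,3,5) cr(2)]
  note st1 = cross_at_strand[OF tw tg ABE(1,2,4) cr(1)]
    and st2 = cross_at_strand[OF tw tg ABE(1,3,5) cr(2)]
    and st3 = cross_at_strand[OF tw tg ABE(2,3,6) cr(3)]
  show pr: "p \<noteq> r"
  proof
    assume "p = r"
    hence "curve K s = curve K p" using f2(6) by simp
    from st1[OF ABE(3) f2(5) this] show False using ABE(5,6) by blast
  qed
  thus neq: "curve K p \<noteq> curve K r"
    using st1[OF ABE(1) f2(4)] ABE(4) by metis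
  have S: "passages K C \<inter> interval A = {w\<in>{p, r}. curve K w \<in> C}"
    unfolding passages_Int_interval[OF tg ABE(1)]
  proof (intro Collect_cong iffI; elim conjE)
    fix w assume w: "w \<in> interval A" "curve K w \<in> C \<inter> interior D"
    have "curve K w = curve K p \<or> curve K w = curve K r \<or> curve K w = curve K u"
      using w(2) C by auto
    hence "w = p \<or> w = r"
      using st1[OF ABE(1) w(1)] st2[OF ABE(1) w(1)] st3[OF ABE(1) w(1)] ABE(4,5) by blast
    thus "w \<in> {p, r} \<and> curve K w \<in> C" using w(2) by auto
  next
    fix w assume w: "w \<in> {p, r}" "curve K w \<in> C"
    thus "w \<in> interval A \<and> curve K w \<in> C \<inter> interior D"
      using f1(4,8) f2(4,8) by auto
  qed
  have "{w\<in>{p, r}. curve K w \<in> C} \<inter> {..<p} = (if curve K r \<in> C \<and> r < p then {r} else {})"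
    "{w\<in>{p, r}. curve K w \<in> C} \<inter> {..<r} = (if curve K p \<in> C \<and> p < r then {p} else {})"
    by auto
  thus "local_count (passages K C) A p = of_bool (curve K r \<in> C \<and> r < p)"
    "local_count (passages K C) A r = of_bool (curve K p \<in> C \<and> p < r)"
    unfolding local_count_def S by auto
  have "{w\<in>{p, r}. curve K w \<in> C} =
      (if curve K p \<in> C then {p} else {}) \<union> (if curve K r \<in> C then {r} else {})"
    by auto
  thus "card (passages K C \<inter> interval A) = of_bool (curve K p \<in> C) + of_bool (curve K r \<in> C)"
    unfolding S using pr by simp
qed

lemma triangle_crossings:
  assumes tw: "twisted_knot_diagram K" and tg: "tangle_in_disc D [A, B, E] K"
    and tri: "triangle D K A B E"
  shows "cross_at K A B (meet K A B) (meet K B A)" "cross_at K A E (meet K A E) (meet K E A)"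
    "cross_at K B E (meet K B E) (meet K E B)"
    "curve K (meet K B A) = curve K (meet K A B)" "curve K (meet K E A) = curve K (meet K A E)"
    "curve K (meet K E B) = curve K (meet K B E)"
proof -
  have d: "A \<noteq> B" "A \<noteq> E" "B \<noteq> E"
    using tangle_distinct[OF tg] by auto
  show "cross_at K A B (meet K A B) (meet K B A)" "cross_at K A E (meet K A E) (meet K E A)"
    "cross_at K B E (meet K B E) (meet K E B)"
    using tri unfolding triangle_def
    by (simp_all add: crosses_once_meet[OF tw tg] d)
  thus "curve K (meet K B A) = curve K (meet K A B)" "curve K (meet K E A) = curve K (meet K A E)"
    "curve K (meet K E B) = curve K (meet K B E)"
    by (auto simp: cross_at_def)
qed

lemma triangle_counts:
  assumes tw: "twisted_knot_diagram K" and tg: "tangle_in_disc D [A, B, E] K"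
    and tri: "triangle D K A B E" and C: "C \<subseteq> classical_crossings K"
  defines "p \<equiv> meet K A B" and "q \<equiv> meet K B A" and "r \<equiv> meet K A E"
    and "s \<equiv> meet K E A" and "u \<equiv> meet K B E" and "v \<equiv> meet K E B"
  shows "p \<noteq> r" "q \<noteq> u" "s \<noteq> v"
    "curve K p \<noteq> curve K r" "curve K p \<noteq> curve K u" "curve K r \<noteq> curve K u"
    "local_count (passages K C) A p = of_bool (curve K r \<in> C \<and> r < p)"
    "local_count (passages K C) A r = of_bool (curve K p \<in> C \<and> p < r)"
    "local_count (passages K C) B q = of_bool (curve K u \<in> C \<and> u < q)"
    "local_count (passages K C) B u = of_bool (curve K p \<in> C \<and> q < u)"
    "local_count (passages K C) E s = of_bool (curve K u \<in> C \<and> v < s)"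
    "local_count (passages K C) E v = of_bool (curve K r \<in> C \<and> s < v)"
    "card (passages K C \<inter> interval A) = of_bool (curve K p \<in> C) + of_bool (curve K r \<in> C)"
    "card (passages K C \<inter> interval B) = of_bool (curve K p \<in> C) + of_bool (curve K u \<in> C)"
    "card (passages K C \<inter> interval E) = of_bool (curve K r \<in> C) + of_bool (curve K u \<in> C)"
proof -
  note t = triangle_crossings[OF tw tg tri, folded p_def q_def r_def s_def u_def v_def]
  have d: "A \<noteq> B" "A \<noteq> E" "B \<noteq> E"
    using tangle_distinct[OF tg] by auto
  have m: "A \<in> set [A, B, E]" "B \<in> set [A, B, E]" "E \<in> set [A, B, E]" by auto
  have "C \<inter> interior D \<subseteq> double_points_in D K"
    using C by (auto simp: double_points_in_def classical_crossings_def)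
  hence C': "C \<inter> interior D \<subseteq> {curve K p, curve K r, curve K u}"
    using tri unfolding triangle_def p_def r_def u_def by simp
  have C'': "C \<inter> interior D \<subseteq> {curve K q, curve K u, curve K r}"
    "C \<inter> interior D \<subseteq> {curve K s, curve K v, curve K p}"
    using C' unfolding t(4-6) by auto
  \<comment> \<open>Each side is obtained by a permutation of the strands, which reads some
    crossings from their other strand; \<open>t(4-6)\<close> brings them back to one name per
    crossing.\<close>
  note onA = two_crossings_on_strand[OF tw tg m d t(1-3) C']
  note onB = two_crossings_on_strand[OF tw tg m(2,1,3) d(1)[symmetric] d(3,2)
      t(1)[unfolded cross_at_commute[of K A]] t(3,2) C''(1), unfolded t(4-6)]
  note onE = two_crossings_on_strand[OF tw tg m(3,1,2) d(2)[symmetric] d(3)[symmetric] d(1)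
      t(2)[unfolded cross_at_commute[of K A]] t(3)[unfolded cross_at_commute[of K B]] t(1)
      C''(2), unfolded t(4-6)]
  show "p \<noteq> r" "q \<noteq> u" "s \<noteq> v"
    "curve K p \<noteq> curve K r" "curve K p \<noteq> curve K u" "curve K r \<noteq> curve K u"
    "local_count (passages K C) A p = of_bool (curve K r \<in> C \<and> r < p)"
    "local_count (passages K C) A r = of_bool (curve K p \<in> C \<and> p < r)"
    "local_count (passages K C) B q = of_bool (curve K u \<in> C \<and> u < q)"
    "local_count (passages K C) B u = of_bool (curve K p \<in> C \<and> q < u)"
    "local_count (passages K C) E s = of_bool (curve K u \<in> C \<and> v < s)"
    "local_count (passages K C) E v = of_bool (curve K r \<in> C \<and> s < v)"
    "card (passages K C \<inter> interval A) = of_bool (curve K p \<in> C) + of_bool (curve K r \<in> C)"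
    "card (passages K C \<inter> interval B) = of_bool (curve K p \<in> C) + of_bool (curve K u \<in> C)"
    "card (passages K C \<inter> interval E) = of_bool (curve K r \<in> C) + of_bool (curve K u \<in> C)"
    by (fact onA onB onE)+
qed

text \<open>
  The three indices together count every passage outside the triangle an even number of times, so
  an even number of them is odd.
\<close>

lemma triangle_zero_crossings:
  assumes tw: "twisted_knot_diagram K" and tg: "tangle_in_disc D [A, B, E] K"
    and tri: "triangle D K A B E"
    and vir: "virtuals K \<inter> interior D = {}"
  shows "curve K (meet K A B) \<in> zero_crossings K \<longleftrightarrow>
    (curve K (meet K A E) \<in> zero_crossings K \<longleftrightarrow> curve K (meet K B E) \<in> zero_crossings K)"
proof -
  note t = triangle_crossings[OF tw tg tri]
  note c = triangle_counts[OF tw tg tri order_refl]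
  have d: "A \<noteq> B" "A \<noteq> E" "B \<noteq> E"
    using tangle_distinct[OF tg] by auto
  have m: "A \<in> set [A, B, E]" "B \<in> set [A, B, E]" "E \<in> set [A, B, E]" by auto
  note f1 = cross_at_facts[OF tw tg m(1,2) d(1) t(1)]
    and f2 = cross_at_facts[OF tw tg m(1,3) d(2) t(2)]
    and f3 = cross_at_facts[OF tw tg m(2,3) d(3) t(3)]
  have cc: "curve K (meet K A B) \<in> classical_crossings K"
    "curve K (meet K A E) \<in> classical_crossings K"
    "curve K (meet K B E) \<in> classical_crossings K"
    using f1(7,8) f2(7,8) f3(7,8) vir unfolding classical_crossings_def by auto
  note inside = count_below_inside[OF finite_passages[OF tw order_refl]]
  \<comment> \<open>The beginning of each strand occurs in two of the three sums, and each strand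
    contributes exactly one local passage in total. So the three sums add up to an odd number, and
    an odd number of the crossings are zero crossings.\<close>
  show ?thesis
    unfolding zero_crossing_iff[OF tw cc(1) f1(1-3) refl f1(6)]
      zero_crossing_iff[OF tw cc(2) f2(1-3) refl f2(6)]
      zero_crossing_iff[OF tw cc(3) f3(1-3) refl f3(6)]
      inside[OF f1(4)] inside[OF f1(5)] inside[OF f2(4)] inside[OF f2(5)]
      inside[OF f3(4)] inside[OF f3(5)] c(7-12)
    using c(1-3) cc by (auto simp: even_add)
qed

text \<open>Reversing the order on both strands through a crossing changes its local count once for
  each of the other two crossings that is counted. For classical passages both are counted and the
  changes cancel. For zero passages they cancel exactly if both or neither of the other two are zero
  crossings, and by \<open>triangle_zero_crossings\<close> this is the case at every zero crossing.
  At the remaining crossings the exponent of \<open>s_var\<close> is constantly 1, so nothing has to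
  cancel.\<close>

lemma (in replacement) triangle_slide:
  assumes As: "As = [A, B, E]" and bars: "bars_in As K = {}" "bars_in As K' = {}"
    and tm: "triangle_move D A B E K K'"
    and vir: "virtuals K \<inter> interior D = {}" "virtuals K' \<inter> interior D = {}"
    and ov: "meet K A B \<in> overs K" "meet K A E \<in> overs K" "meet K B E \<in> overs K"
    and ov': "meet K' A B \<in> overs K'" "meet K' A E \<in> overs K'" "meet K' B E \<in> overs K'"
  shows "Qz K = Qz K'"
proof -
  note tg1 = tg[unfolded As] and tg1' = tg'[unfolded As]
  have tri: "triangle D K A B E" "triangle D K' A B E"
    and flip: "meet K A B < meet K A E \<longleftrightarrow> meet K' A E < meet K' A B"
      "meet K B A < meet K B E \<longleftrightarrow> meet K' B E < meet K' B A"
      "meet K E A < meet K E B \<longleftrightarrow> meet K' E B < meet K' E A"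
    and trn: "turn K (meet K A B) (meet K B A) = turn K' (meet K' A B) (meet K' B A)"
      "turn K (meet K A E) (meet K E A) = turn K' (meet K' A E) (meet K' E A)"
      "turn K (meet K B E) (meet K E B) = turn K' (meet K' B E) (meet K' E B)"
    using tm unfolding triangle_move_def by auto
  note t = triangle_crossings[OF tw tg1 tri(1)] and t' = triangle_crossings[OF tw' tg1' tri(2)]
  note c = triangle_counts[OF tw tg1 tri(1)] and c' = triangle_counts[OF tw' tg1' tri(2)]
  have d: "A \<noteq> B" "A \<noteq> E" "B \<noteq> E"
    using tangle_distinct[OF tg1] by auto
  have m: "A \<in> set As" "B \<in> set As" "E \<in> set As" by (auto simp: As)
  have cI: "classical_crossings K \<inter> interior D =
      {curve K (meet K A B), curve K (meet K A E), curve K (meet K B E)}"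
    "classical_crossings K' \<inter> interior D =
      {curve K' (meet K' A B), curve K' (meet K' A E), curve K' (meet K' B E)}"
    unfolding classical_crossings_inside using tri vir
    by (auto simp: triangle_def double_points_in_def)
  hence cc: "curve K (meet K A B) \<in> classical_crossings K"
      "curve K (meet K A E) \<in> classical_crossings K" "curve K (meet K B E) \<in> classical_crossings K"
    and cc': "curve K' (meet K' A B) \<in> classical_crossings K'"
      "curve K' (meet K' A E) \<in> classical_crossings K'"
      "curve K' (meet K' B E) \<in> classical_crossings K'"
    by auto
  note n = c(1-6)[OF order_refl] and n' = c'(1-6)[OF order_refl]
  have pos: "meet K A E < meet K A B \<longleftrightarrow> meet K' A B < meet K' A E"
    "meet K B E < meet K B A \<longleftrightarrow> meet K' B A < meet K' B E"
    "meet K E B < meet K E A \<longleftrightarrow> meet K' E A < meet K' E B"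
    using flip n(1-3) n'(1-3) by auto
  have X: "parity_agree As (passages K (classical_crossings K))
      (passages K' (classical_crossings K'))"
  proof (rule parity_agree_classicalI)
    fix S assume "S \<in> set As"
    hence "S = A \<or> S = B \<or> S = E" by (auto simp: As)
    thus "even (card (passages K (classical_crossings K) \<inter> interval S)) =
        even (card (passages K' (classical_crossings K') \<inter> interval S))"
      using c(13-15)[OF order_refl] c'(13-15)[OF order_refl] cc cc' by auto
  qed
  \<comment> \<open>Together with \<open>pos\<close> this expresses all twelve comparisons through
    three Boolean atoms, the orders on the three strands in \<open>K'\<close>. What remains in each
    case is propositional.\<close>
  have rev: "meet K A B < meet K A E \<longleftrightarrow> \<not> meet K' A B < meet K' A E"
    "meet K B A < meet K B E \<longleftrightarrow> \<not> meet K' B A < meet K' B E"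
    "meet K E A < meet K E B \<longleftrightarrow> \<not> meet K' E A < meet K' E B"
    "meet K' A E < meet K' A B \<longleftrightarrow> \<not> meet K' A B < meet K' A E"
    "meet K' B E < meet K' B A \<longleftrightarrow> \<not> meet K' B A < meet K' B E"
    "meet K' E B < meet K' E A \<longleftrightarrow> \<not> meet K' E A < meet K' E B"
    using flip n'(1-3) by auto
  note lcX = c(7-12)[OF order_refl] c'(7-12)[OF order_refl]
  have "curve K (meet K A B) \<in> zero_crossings K \<longleftrightarrow>
      curve K' (meet K' A B) \<in> zero_crossings K'"
    by (rule zero_crossing_inside_iff[OF m(1,2) d(1) t(1) t'(1) cc(1) cc'(1) X])
      (simp add: lcX cc cc' pos rev; blast)
  moreover have "curve K (meet K A E) \<in> zero_crossings K \<longleftrightarrow>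
      curve K' (meet K' A E) \<in> zero_crossings K'"
    by (rule zero_crossing_inside_iff[OF m(1,3) d(2) t(2) t'(2) cc(2) cc'(2) X])
      (simp add: lcX cc cc' pos rev; blast)
  moreover have "curve K (meet K B E) \<in> zero_crossings K \<longleftrightarrow>
      curve K' (meet K' B E) \<in> zero_crossings K'"
    by (rule zero_crossing_inside_iff[OF m(2,3) d(3) t(3) t'(3) cc(3) cc'(3) X])
      (simp add: lcX cc cc' pos rev; blast)
  ultimately have zero: "curve K (meet K A B) \<in> zero_crossings K \<longleftrightarrow>
      curve K' (meet K' A B) \<in> zero_crossings K'"
    "curve K (meet K A E) \<in> zero_crossings K \<longleftrightarrow> curve K' (meet K' A E) \<in> zero_crossings K'"
    "curve K (meet K B E) \<in> zero_crossings K \<longleftrightarrow> curve K' (meet K' B E) \<in> zero_crossings K'"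
    by blast+
  have Z: "parity_agree As (passages K (zero_crossings K)) (passages K' (zero_crossings K'))"
  proof (rule parity_agree_zeroI[OF X])
    fix S assume "S \<in> set As"
    hence "S = A \<or> S = B \<or> S = E" by (auto simp: As)
    thus "even (card (passages K (zero_crossings K) \<inter> interval S)) =
        even (card (passages K' (zero_crossings K') \<inter> interval S))"
      using c(13-15)[OF zero_crossings_subset] c'(13-15)[OF zero_crossings_subset] zero by auto
  qed
  note Bs = parity_agree_no_bars[OF bars]
  note b0 = bars_inD(2)[OF bars(1) m(1)] bars_inD(2)[OF bars(1) m(2)] bars_inD(2)[OF bars(1) m(3)]
    bars_inD(2)[OF bars(2) m(1)] bars_inD(2)[OF bars(2) m(2)] bars_inD(2)[OF bars(2) m(3)]
  note three = triangle_zero_crossings[OF tw tg1 tri(1) vir(1)]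
  note sgnI = crossing_signI[OF tw tg m(1,2) d(1) t(1) cc(1) ov(1)]
      crossing_signI[OF tw tg m(1,3) d(2) t(2) cc(2) ov(2)]
      crossing_signI[OF tw tg m(2,3) d(3) t(3) cc(3) ov(3)]
      crossing_signI[OF tw' tg' m(1,2) d(1) t'(1) cc'(1) ov'(1)]
      crossing_signI[OF tw' tg' m(1,3) d(2) t'(2) cc'(2) ov'(2)]
      crossing_signI[OF tw' tg' m(2,3) d(3) t'(3) cc'(3) ov'(3)]
  note lc = c(7-12)[OF zero_crossings_subset] c'(7-12)[OF zero_crossings_subset]
  have "crossing_term K (curve K (meet K A B)) = crossing_term K' (curve K' (meet K' A B))"
  proof (rule crossing_term_inside[OF m(1,2) d(1) t(1) t'(1) cc(1) cc'(1) Bs _ _ zero(1) Z])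
  qed (simp_all add: b0 sgnI trn lc pos rev zero[symmetric], use three in blast)
  moreover have
    "crossing_term K (curve K (meet K A E)) = crossing_term K' (curve K' (meet K' A E))"
  proof (rule crossing_term_inside[OF m(1,3) d(2) t(2) t'(2) cc(2) cc'(2) Bs _ _ zero(2) Z])
  qed (simp_all add: b0 sgnI trn lc pos rev zero[symmetric], use three in blast)
  moreover have
    "crossing_term K (curve K (meet K B E)) = crossing_term K' (curve K' (meet K' B E))"
  proof (rule crossing_term_inside[OF m(2,3) d(3) t(3) t'(3) cc(3) cc'(3) Bs _ _ zero(3) Z])
  qed (simp_all add: b0 sgnI trn lc pos rev zero[symmetric], use three in blast)
  ultimately show ?thesis
    by (intro Qz_eqI[OF X Z Bs]) (simp add: cI n(4-6) n'(4-6))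
qed

section \<open>The individual moves\<close>

lemma bars_in_subset_Int:
  assumes "tangle_in_disc D As K" "A \<in> set As" "bars_in As K = U \<union> W" "U \<subseteq> interval A"
    "\<And>w. w \<in> W \<Longrightarrow> \<exists>B\<in>set As. B \<noteq> A \<and> w \<in> interval B"
  shows "bars K \<inter> interval A = U"
proof -
  have "W \<inter> interval A = {}"
    using assms(5) tangle_intervals_disjoint[OF assms(1) _ assms(2)] by blast
  moreover have "bars K \<inter> interval A = bars_in As K \<inter> interval A"
    using assms(2) by (auto simp: bars_in_def inner_def)
  ultimately show ?thesis using assms(3,4) by auto
qed

theorem local_move_Qz:
  assumes "local_move mv K K'"
  shows "Qz K = Qz K'"
  using assms
proof cases
  case (C1 D A c)
  then interpret replacement D "[A]" K K' by unfold_locales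
  show ?thesis by (rule kink[OF refl C1(3-7)])
next
  case (C2 D A B x1 y1 x2 y2)
  then interpret replacement D "[A, B]" K K' by unfold_locales
  show ?thesis by (rule bigon_move[OF refl C2(3-9)])
next
  case (C3 D A B E)
  then interpret replacement D "[A, B, E]" K K' by unfold_locales
  show ?thesis by (rule triangle_slide[OF refl C3(3-13)])
next
  case (V1 D A c)
  then interpret replacement D "[A]" K K' by unfold_locales
  show ?thesis
    by (rule no_classical_inside)
      (use V1 in \<open>auto simp: classical_crossings_inside intro: parity_agree_no_bars\<close>)
next
  case (V2 D A B x1 y1 x2 y2)
  then interpret replacement D "[A, B]" K K' by unfold_locales
  show ?thesis
    by (rule no_classical_inside)
      (use V2 in \<open>auto simp: classical_crossings_inside intro: parity_agree_no_bars\<close>)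
next
  case (V3 D A B E)
  then interpret replacement D "[A, B, E]" K K' by unfold_locales
  show ?thesis
    by (rule no_classical_inside)
      (use V3 in \<open>auto simp: classical_crossings_inside intro: parity_agree_no_bars\<close>)
next
  case (V4 D A B E)
  then interpret replacement D "[A, B, E]" K K' by unfold_locales
  have tri: "triangle D K A B E" "triangle D K' A B E"
    and trn: "turn K (meet K B E) (meet K E B) = turn K' (meet K' B E) (meet K' E B)"
    using V4 unfolding triangle_move_def by auto
  note t = triangle_crossings[OF tw tg tri(1)] and t' = triangle_crossings[OF tw' tg' tri(2)]
  note n = triangle_counts(4-6)[OF tw tg tri(1) order_refl]
    and n' = triangle_counts(4-6)[OF tw' tg' tri(2) order_refl]
  \<comment> \<open>Of the three crossings only that of \<open>B\<close> with \<open>E\<close> is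
    classical, so the strand \<open>A\<close> is invisible to every count.\<close>
  have I: "classical_crossings K \<inter> interior D = {curve K (meet K B E)}"
    "classical_crossings K' \<inter> interior D = {curve K' (meet K' B E)}"
  proof -
    have e: "classical_crossings L \<inter> interior D = double_points_in D L - (virtuals L \<inter> interior D)" for L
      unfolding classical_crossings_inside by (auto simp: double_points_in_def)
    show "classical_crossings K \<inter> interior D = {curve K (meet K B E)}"
      unfolding e V4(6) using tri(1) n unfolding triangle_def by auto
    show "classical_crossings K' \<inter> interior D = {curve K' (meet K' B E)}"
      unfolding e V4(7) using tri(2) n' unfolding triangle_def by auto
  qed
  have m: "B \<in> set [A, B, E]" "E \<in> set [A, B, E]" "B \<noteq> E"
    using tangle_distinct[OF tg] by auto
  have cc: "curve K (meet K B E) \<in> classical_crossings K"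
    "curve K' (meet K' B E) \<in> classical_crossings K'"
    using I by auto
  show ?thesis
  proof (rule one_classical_inside[OF m t(3) t'(3) I])
    show "crossing_sign K (curve K (meet K B E)) = crossing_sign K' (curve K' (meet K' B E))"
      using crossing_signI[OF tw tg m t(3) cc(1)] crossing_signI[OF tw' tg' m t'(3) cc(2)] trn V4
      by simp
    show "parity_agree [A, B, E] (bars K) (bars K')"
      by (rule parity_agree_no_bars) (use V4 in auto)
  qed (simp add: bars_inD(2)[OF V4(3)] bars_inD(2)[OF V4(4)])
next
  case (T1 D A u1 u2)
  then interpret replacement D "[A]" K K' by unfold_locales
  have "parity_agree [A] (bars K) (bars K')"
  proof (rule parity_agree_barsI)
    fix S assume S: "S \<in> set [A]"
    have "bars K \<inter> interval S = {}" "bars K' \<inter> interval S = {u1, u2}"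
      using T1 S by (auto simp: bars_in_def inner_def)
    thus "even (card (bars K \<inter> interval S)) = even (card (bars K' \<inter> interval S))"
      using T1 by simp
  qed
  thus ?thesis
    by (intro no_classical_inside) (use T1 in \<open>auto simp: classical_crossings_inside\<close>)
next
  case (T2 D A B x y x' y' u u')
  then interpret replacement D "[A, B]" K K' by unfold_locales
  have m: "A \<in> set [A, B]" "B \<in> set [A, B]" "A \<noteq> B"
    using tangle_distinct[OF tg] by auto
  \<comment> \<open>The bar stays on its strand, and no classical crossing in the disc can tell on
    which side of the virtual crossing it lies.\<close>
  have "parity_agree [A, B] (bars K) (bars K')"
  proof (rule parity_agree_barsI)
    fix S assume S: "S \<in> set [A, B]"
    have "bars K \<inter> interval A = {u}" "bars K' \<inter> interval A = {u'}"
      using bars_in_subset_Int[OF tg m(1), of "{u}" "{}"]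
        bars_in_subset_Int[OF tg' m(1), of "{u'}" "{}"] T2 by auto
    moreover have "bars K \<inter> interval B = {}" "bars K' \<inter> interval B = {}"
      using bars_in_subset_Int[OF tg m(2), of "{}" "{u}"]
        bars_in_subset_Int[OF tg' m(2), of "{}" "{u'}"] T2 m by auto
    ultimately show "even (card (bars K \<inter> interval S)) = even (card (bars K' \<inter> interval S))"
      using S by auto
  qed
  thus ?thesis
    by (intro no_classical_inside)
      (use T2 in \<open>auto simp: classical_crossings_inside single_crossing_def\<close>)
next
  case (T3 D A B x y u1 u2 w1 w2 x1 y1 x2 y2 x3 y3)
  then interpret replacement D "[A, B]" K K' by unfold_locales
  have m: "A \<in> set [A, B]" "B \<in> set [A, B]" "A \<noteq> B"
    using tangle_distinct[OF tg] by auto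
  have I: "classical_crossings K \<inter> interior D = {curve K x}"
    "classical_crossings K' \<inter> interior D = {curve K' x2}"
    using T3 by (auto simp: classical_crossings_inside single_crossing_def)
  have cr: "cross_at K A B x y" "cross_at K' A B x2 y2"
    using T3 by (auto simp: single_crossing_def)
  have b: "bars K \<inter> interval A = {u1, u2}" "bars K \<inter> interval B = {w1, w2}"
    using bars_in_subset_Int[OF tg m(1), of "{u1, u2}" "{w1, w2}"]
      bars_in_subset_Int[OF tg m(2), of "{w1, w2}" "{u1, u2}"] T3 m by auto
  have b': "bars K' \<inter> interval A = {}" "bars K' \<inter> interval B = {}"
    using bars_inD(1)[of "[A, B]" K'] m T3 by auto
  have card: "card (bars K \<inter> interval A) = 2" "card (bars K \<inter> interval B) = 2"
    using T3 unfolding b by auto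
  have "{u1, u2} \<inter> {..<x} = {u1}" "{w1, w2} \<inter> {..<y} = {w1}"
    using T3 by auto
  \<comment> \<open>Before the move there is one bar ahead of the crossing on each of the two
    strands, afterwards none: 1 + 1 and 0 + 0 have the same parity.\<close>
  hence lc: "local_count (bars K) A x = 1" "local_count (bars K) B y = 1"
    "local_count (bars K') A x2 = 0" "local_count (bars K') B y2 = 0"
    unfolding local_count_def b b' by auto
  have "parity_agree [A, B] (bars K) (bars K')"
  proof (rule parity_agree_barsI)
    fix S assume "S \<in> set [A, B]"
    hence "S = A \<or> S = B" by simp
    thus "even (card (bars K \<inter> interval S)) = even (card (bars K' \<inter> interval S))"
      by (elim disjE) (simp_all add: card b')
  qed
  \<comment> \<open>The over strand changes, but this merely exchanges the two components, to which
    the term is insensitive. Hence equality of signs is all that is asked of the crossing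
    information.\<close>
  thus ?thesis
    using one_classical_inside[OF m cr I] T3 lc by simp
qed

section \<open>Planar isotopy\<close>

text \<open>Multiplicativity of the determinant: \<open>Im (cnj (L 1) * L \<i>)\<close> is the
  determinant of \<open>L\<close> with respect to the basis 1, \<i>.\<close>

lemma linear_complex_det:
  fixes L :: "complex \<Rightarrow> complex"
  assumes "linear L"
  shows "Im (cnj (L u) * L w) = Im (cnj (L 1) * L \<i>) * Im (cnj u * w)"
proof -
  have L: "L z = Re z *\<^sub>R L 1 + Im z *\<^sub>R L \<i>" for z
  proof -
    have "z = Re z *\<^sub>R 1 + Im z *\<^sub>R \<i>" by (simp add: complex_eq_iff)
    hence "L z = L (Re z *\<^sub>R 1 + Im z *\<^sub>R \<i>)" by simp
    also have "\<dots> = Re z *\<^sub>R L 1 + Im z *\<^sub>R L \<i>"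
      by (simp only: linear_add[OF assms] linear_scale[OF assms])
    finally show ?thesis .
  qed
  show ?thesis unfolding L[of u] L[of w] by (simp add: algebra_simps)
qed

text \<open>Along the isotopy the determinant at a fixed point \<open>p\<close> is continuous in
  time, starts at 1 because \<open>H 0 = id\<close>, and never vanishes because the derivatives are
  bijective; by the intermediate value theorem it stays positive.\<close>

lemma plane_isotopy_det_pos:
  assumes "plane_isotopy H"
  obtains L where "(H 1 has_derivative L) (at p)" "Im (cnj (L 1) * L \<i>) > 0"
proof -
  obtain D :: "real \<Rightarrow> complex \<Rightarrow> complex \<Rightarrow>\<^sub>L complex" where
    D: "\<And>t p. t \<in> {0..1} \<Longrightarrow> (H t has_derivative blinfun_apply (D t p)) (at p)"
      "\<And>t p. t \<in> {0..1} \<Longrightarrow> bij (blinfun_apply (D t p))"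
      "continuous_on ({0..1} \<times> UNIV) (\<lambda>(t, p). D t p)"
    using assms unfolding plane_isotopy_def by blast
  define g where "g t = Im (cnj (D t p 1) * D t p \<i>)" for t
  have "continuous_on {0..1} ((\<lambda>(t, p). D t p) \<circ> (\<lambda>t. (t, p)))"
    by (intro continuous_on_compose continuous_on_subset[OF D(3)] continuous_intros) auto
  hence "continuous_on {0..1} (\<lambda>t. D t p)" by (simp add: o_def)
  hence cont: "continuous_on {0..1} g" unfolding g_def by (intro continuous_intros)
  have nz: "g t \<noteq> 0" if "t \<in> {0..1}" for t
  proof
    assume "g t = 0"
    hence 0: "Im (cnj (D t p u) * D t p w) = 0" for u w
      using linear_complex_det[of "blinfun_apply (D t p)" u w]
      by (simp add: g_def blinfun.bounded_linear_right bounded_linear.linear)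
    \<comment> \<open>A vanishing determinant would make all values of the derivative linearly
      dependent, but the independent vectors 1 and \<i> are among them.\<close>
    have "surj (blinfun_apply (D t p))" using D(2)[OF that] by (rule bij_is_surj)
    then obtain u w where "D t p u = 1" "D t p w = \<i>" by (metis surjD)
    thus False using 0[of u w] by simp
  qed
  have "(H 0 has_derivative id) (at p)"
    using assms unfolding plane_isotopy_def by (auto simp: id_def)
  hence "blinfun_apply (D 0 p) = id"
    using has_derivative_unique[OF D(1)[of 0 p]] by auto
  hence g0: "g 0 = 1" by (simp add: g_def)
  have "g 1 > 0"
  proof (rule ccontr)
    assume "\<not> g 1 > 0"
    then obtain t where "0 \<le> t" "t \<le> 1" "g t = 0"
      using IVT2'[of g 1 0 0] cont g0 by auto
    thus False using nz[of t] by auto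
  qed
  thus ?thesis using that[OF D(1)[of 1 p]] by (simp add: g_def)
qed

section \<open>Transport of all data along an isotopy\<close>

locale isotopy =
  fixes K K' :: diagram and H :: "real \<Rightarrow> complex \<Rightarrow> complex" and \<phi> :: "real \<Rightarrow> real"
  assumes tw: "twisted_knot_diagram K" and tw': "twisted_knot_diagram K'"
    and H: "plane_isotopy H" and \<phi>: "reparametrization \<phi>"
    and curve_eq: "curve K' (\<phi> x) = H 1 (curve K x)"
    and virtuals_eq: "virtuals K' = H 1 ` virtuals K"
    and overs_eq: "overs K' = (\<lambda>x. frac (\<phi> x)) ` overs K"
    and bars_eq: "bars K' = (\<lambda>x. frac (\<phi> x)) ` bars K"
begin

text \<open>The map that \<open>\<phi>\<close> induces on the parameters in [0,1). It may move the
  base point and hence need not be monotone; only the cyclic order survives.\<close>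

definition \<psi> :: "real \<Rightarrow> real" where "\<psi> x = frac (\<phi> x)"

abbreviation f :: "complex \<Rightarrow> complex" where "f \<equiv> H 1"

lemma bij_f: "bij f"
  using H unfolding plane_isotopy_def by auto

lemma f_eq_iff: "f a = f b \<longleftrightarrow> a = b"
  using bij_f by (metis bij_is_inj inj_eq)

lemma deriv_\<phi>: "\<exists>\<phi>'. \<forall>x. (\<phi> has_real_derivative \<phi>' x) (at x) \<and> \<phi>' x > 0"
  using \<phi> unfolding reparametrization_def by blast

lemma \<phi>_less_iff: "\<phi> x < \<phi> y \<longleftrightarrow> x < y"
proof -
  obtain \<phi>' where d: "\<And>x. (\<phi> has_real_derivative \<phi>' x) (at x)" "\<And>x. \<phi>' x > 0"
    using deriv_\<phi> by metis
  have "strict_mono \<phi>"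
  proof (rule strict_monoI)
    show "\<phi> a < \<phi> b" if "a < b" for a b
      by (rule DERIV_pos_imp_increasing[OF that]) (metis d)
  qed
  thus ?thesis by (simp add: strict_mono_less)
qed

lemma continuous_\<phi>: "continuous_on S \<phi>"
proof -
  obtain \<phi>' where "\<And>x. (\<phi> has_real_derivative \<phi>' x) (at x)" "\<And>x. \<phi>' x > 0"
    using deriv_\<phi> by metis
  thus ?thesis
    by (intro continuous_at_imp_continuous_on ballI DERIV_isCont)
qed

lemma \<phi>_add_int: "\<phi> (x + of_int n) = \<phi> x + of_int n"
proof (induction n arbitrary: x rule: int_induct[where k = 0])
  case (step1 i)
  have "\<phi> (y + 1) = \<phi> y + 1" for y using \<phi> unfolding reparametrization_def by blast
  from this[of "x + of_int i"] show ?case using step1(2)[of x] by (simp add: add.assoc)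
next
  case (step2 i)
  have "\<phi> (y + 1) = \<phi> y + 1" for y using \<phi> unfolding reparametrization_def by blast
  from this[of "x + of_int (i - 1)"] show ?case using step2(2)[of x] by simp
qed simp

lemma curve_add_int:
  assumes "twisted_knot_diagram L"
  shows "curve L (x + of_int n) = curve L x"
proof (induction n arbitrary: x rule: int_induct[where k = 0])
  case (step1 i)
  have "curve L (y + 1) = curve L y" for y
    using assms unfolding twisted_knot_diagram_def generic_closed_curve_def by blast
  from this[of "x + of_int i"] show ?case using step1(2)[of x] by (simp add: add.assoc)
next
  case (step2 i)
  have "curve L (y + 1) = curve L y" for y
    using assms unfolding twisted_knot_diagram_def generic_closed_curve_def by blast
  from this[of "x + of_int (i - 1)"] show ?case using step2(2)[of x] by simp
qed simp

lemma \<psi>_eq: "\<psi> x = \<phi> x + of_int (- \<lfloor>\<phi> x\<rfloor>)"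
  by (simp add: \<psi>_def frac_def)

lemma \<psi>_unit: "\<psi> x \<in> {0..<1}"
  by (simp add: \<psi>_def frac_lt_1)

lemma curve_\<psi>: "curve K' (\<psi> x) = f (curve K x)"
  unfolding \<psi>_eq curve_add_int[OF tw'] by (rule curve_eq)

text \<open>The forward distance from \<open>a\<close> is transformed by
  \<open>s \<mapsto> \<phi> (a + s) - \<phi> a\<close>, which is strictly increasing and vanishes at
  0. Comparing distances from a common starting point is therefore compatible with
  \<open>\<psi>\<close>, wherever the base point goes.\<close>

lemma frac_\<phi>_diff: "frac (\<psi> x - \<psi> a) = \<phi> (a + frac (x - a)) - \<phi> a"
proof -
  define t where "t = frac (x - a)"
  have t: "0 \<le> t" "t < 1" by (simp_all add: t_def frac_lt_1)
  have x: "x = (a + t) + of_int \<lfloor>x - a\<rfloor>" by (simp add: t_def frac_def)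
  have "\<phi> x = \<phi> (a + t) + of_int \<lfloor>x - a\<rfloor>" using \<phi>_add_int[of "a + t"] x by metis
  hence "frac (\<psi> x - \<psi> a) = frac ((\<phi> (a + t) - \<phi> a) + of_int (\<lfloor>x - a\<rfloor> - \<lfloor>\<phi> x\<rfloor> + \<lfloor>\<phi> a\<rfloor>))"
    by (simp add: \<psi>_eq algebra_simps)
  \<comment> \<open>The real part of the sum already lies in [0,1), since \<open>\<phi>\<close> is
    increasing and \<open>\<phi> (a + 1) = \<phi> a + 1\<close>.\<close>
  also have "\<dots> = \<phi> (a + t) - \<phi> a"
  proof -
    have "\<not> \<phi> (a + t) < \<phi> a" "\<phi> (a + t) < \<phi> (a + of_int 1)"
      unfolding \<phi>_less_iff using t by auto
    thus ?thesis unfolding frac_unique_iff \<phi>_add_int by auto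
  qed
  finally show ?thesis by (simp add: t_def)
qed

lemma \<psi>_in_open_arc_iff:
  assumes "x \<in> {0..<1}"
  shows "\<psi> x \<in> open_arc (\<psi> a) (\<psi> b) \<longleftrightarrow> x \<in> open_arc a b"
proof -
  have "0 < \<phi> (a + s) - \<phi> a \<longleftrightarrow> 0 < s" for s
    using \<phi>_less_iff[of a "a + s"] by simp
  moreover have "\<phi> (a + s) - \<phi> a < \<phi> (a + t) - \<phi> a \<longleftrightarrow> s < t" for s t
    using \<phi>_less_iff[of "a + s" "a + t"] by simp
  ultimately show ?thesis
    unfolding open_arc_def mem_Collect_eq frac_\<phi>_diff using assms \<psi>_unit by blast
qed

lemma inj_on_\<psi>: "inj_on \<psi> {0..<1}"
proof (rule inj_onI)
  fix x y assume xy: "x \<in> {0..<1}" "y \<in> {0..<1}" "\<psi> x = \<psi> y"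
  hence "\<phi> (y + frac (x - y)) = \<phi> y"
    using frac_\<phi>_diff[of x y] by simp
  hence "frac (x - y) = 0"
    using \<phi>_less_iff[of y "y + frac (x - y)"] frac_ge_0[of "x - y"] by linarith
  thus "x = y" using frac_diff_unit_interval[OF xy(2,1)] xy(1,2) by (auto split: if_splits)
qed

lemma \<psi>_surj:
  assumes "y \<in> {0..<1}"
  obtains x where "x \<in> {0..<1}" "\<psi> x = y"
proof -
  \<comment> \<open>The values of \<open>\<phi>\<close> at \<open>-n\<close> and \<open>n\<close>
    are \<open>\<phi> 0 - n\<close> and \<open>\<phi> 0 + n\<close>, so this choice of
    \<open>n\<close> encloses \<open>y\<close> for the intermediate value theorem.\<close>
  obtain n :: int where n: "\<bar>y - \<phi> 0\<bar> \<le> of_int n"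
    using ex_le_of_int by blast
  have "\<phi> (of_int (- n)) \<le> y" "y \<le> \<phi> (of_int n)"
    using \<phi>_add_int[of 0 n] \<phi>_add_int[of 0 "- n"] n by (simp_all add: abs_le_iff)
  moreover have "real_of_int (- n) \<le> of_int n" using n by simp
  ultimately obtain z where z: "\<phi> z = y"
    using IVT'[of \<phi> "of_int (- n)" y "of_int n", OF _ _ _ continuous_\<phi>] by auto
  have "\<phi> (frac z) = \<phi> z + of_int (- \<lfloor>z\<rfloor>)"
    using \<phi>_add_int[of z "- \<lfloor>z\<rfloor>"] by (simp add: frac_def)
  hence "\<psi> (frac z) = y"
    unfolding \<psi>_def using z assms by (simp add: frac_unique_iff)
  thus ?thesis using that[of "frac z"] by (simp add: frac_lt_1)
qed

lemma open_arc_image: "open_arc (\<psi> a) (\<psi> b) = \<psi> ` open_arc a b"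
proof
  show "\<psi> ` open_arc a b \<subseteq> open_arc (\<psi> a) (\<psi> b)"
    using \<psi>_in_open_arc_iff by (auto simp: open_arc_def[of a b])
  show "open_arc (\<psi> a) (\<psi> b) \<subseteq> \<psi> ` open_arc a b"
  proof
    fix y assume y: "y \<in> open_arc (\<psi> a) (\<psi> b)"
    hence "y \<in> {0..<1}" unfolding open_arc_def by blast
    then obtain x where "x \<in> {0..<1}" "\<psi> x = y" by (rule \<psi>_surj)
    thus "y \<in> \<psi> ` open_arc a b" using y \<psi>_in_open_arc_iff by blast
  qed
qed

lemma double_points_image: "double_points K' = f ` double_points K"
proof
  show "f ` double_points K \<subseteq> double_points K'"
  proof
    fix c assume "c \<in> f ` double_points K"
    then obtain x y where xy: "x \<in> {0..<1}" "y \<in> {0..<1}" "x \<noteq> y"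
      "f (curve K x) = c" "f (curve K y) = c"
      unfolding double_points_def by auto
    hence "\<psi> x \<noteq> \<psi> y" using inj_on_\<psi> by (metis inj_onD)
    thus "c \<in> double_points K'"
      using xy(4,5) \<psi>_unit curve_\<psi> unfolding double_points_def mem_Collect_eq by metis
  qed
  show "double_points K' \<subseteq> f ` double_points K"
  proof
    fix c assume "c \<in> double_points K'"
    then obtain x' y' where xy': "x' \<in> {0..<1}" "y' \<in> {0..<1}" "x' \<noteq> y'"
      "curve K' x' = c" "curve K' y' = c"
      unfolding double_points_def by auto
    obtain x y where xy: "x \<in> {0..<1}" "\<psi> x = x'" "y \<in> {0..<1}" "\<psi> y = y'"
      using \<psi>_surj xy'(1,2) by metis
    hence "f (curve K x) = c" "f (curve K y) = c" "x \<noteq> y"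
      using xy' curve_\<psi> by metis+
    thus "c \<in> f ` double_points K"
      using xy f_eq_iff[of "curve K y" "curve K x"] unfolding double_points_def by force
  qed
qed

lemma classical_crossings_image: "classical_crossings K' = f ` classical_crossings K"
  unfolding classical_crossings_def double_points_image virtuals_eq
  using bij_f by (simp add: bij_is_inj image_set_diff)

lemma \<psi>_in_image_iff:
  assumes "x \<in> {0..<1}" "S \<subseteq> {0..<1}"
  shows "\<psi> x \<in> \<psi> ` S \<longleftrightarrow> x \<in> S"
  using inj_on_image_mem_iff[OF inj_on_\<psi> assms] .

lemma overs_iff: "x \<in> {0..<1} \<Longrightarrow> \<psi> x \<in> overs K' \<longleftrightarrow> x \<in> overs K"
proof -
  have "overs K \<subseteq> {0..<1}" using tw unfolding twisted_knot_diagram_def by blast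
  thus "x \<in> {0..<1} \<Longrightarrow> ?thesis"
    using \<psi>_in_image_iff[of x "overs K"] by (simp add: overs_eq \<psi>_def)
qed

lemma has_velocity:
  assumes "twisted_knot_diagram L"
  shows "(curve L has_vector_derivative velocity L x) (at x)"
proof -
  have "curve L differentiable (at x)"
    using assms unfolding twisted_knot_diagram_def generic_closed_curve_def by blast
  thus ?thesis unfolding velocity_def by (rule vector_derivative_works[THEN iffD1])
qed

lemma velocity_add_int:
  assumes "twisted_knot_diagram L"
  shows "velocity L (x + of_int n) = velocity L x"
proof -
  have "((\<lambda>x. x + of_int n) has_vector_derivative 1) (at x)"
    by (auto intro!: derivative_eq_intros)
  from vector_diff_chain_at[OF this, of "curve L" "velocity L (x + of_int n)"]
  have "((curve L \<circ> (\<lambda>x. x + of_int n)) has_vector_derivative velocity L (x + of_int n)) (at x)"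
    using has_velocity[OF assms] by simp
  moreover have "curve L \<circ> (\<lambda>x. x + of_int n) = curve L"
    using curve_add_int[OF assms] by (auto simp: fun_eq_iff)
  ultimately show ?thesis
    using has_velocity[OF assms] vector_derivative_unique_at by metis
qed

text \<open>Differentiating \<open>curve_eq\<close> on both sides shows that \<open>L\<close>
  carries the velocities of \<open>K\<close> to those of \<open>K'\<close>, up to the positive
  factors \<open>\<phi>'\<close>. Both branches pass through the same point, so one derivative
  \<open>L\<close> serves for both, and its determinant is positive.\<close>

lemma turn_\<psi>:
  assumes "curve K a = curve K b"
  shows "turn K' (\<psi> a) (\<psi> b) = turn K a b"
proof -
  obtain L where L: "(f has_derivative L) (at (curve K a))" and det: "Im (cnj (L 1) * L \<i>) > 0"
    using plane_isotopy_det_pos[OF H] by blast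
  obtain \<phi>' where d: "\<And>x. (\<phi> has_real_derivative \<phi>' x) (at x)" and pos: "\<And>x. \<phi>' x > 0"
    using deriv_\<phi> by metis
  have vel: "\<phi>' x *\<^sub>R velocity K' (\<psi> x) = L (velocity K x)" if "curve K x = curve K a" for x
  proof -
    have "velocity K' (\<psi> x) = velocity K' (\<phi> x)"
      unfolding \<psi>_eq by (rule velocity_add_int[OF tw'])
    hence "((curve K' \<circ> \<phi>) has_vector_derivative \<phi>' x *\<^sub>R velocity K' (\<psi> x)) (at x)"
      using vector_diff_chain_at[of \<phi> "\<phi>' x" x "curve K'"] has_velocity[OF tw', of "\<phi> x"] d[of x]
      by (simp add: has_real_derivative_iff_has_vector_derivative)
    moreover have "curve K' \<circ> \<phi> = f \<circ> curve K" using curve_eq by (auto simp: fun_eq_iff)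
    moreover have "((f \<circ> curve K) has_vector_derivative L (velocity K x)) (at x)"
    proof -
      have "(curve K has_derivative (\<lambda>t. t *\<^sub>R velocity K x)) (at x)"
        using has_velocity[OF tw, of x] unfolding has_vector_derivative_def .
      from diff_chain_at[OF this] L that
      have "((f \<circ> curve K) has_derivative (L \<circ> (\<lambda>t. t *\<^sub>R velocity K x))) (at x)" by simp
      moreover have "L \<circ> (\<lambda>t. t *\<^sub>R velocity K x) = (\<lambda>t. t *\<^sub>R L (velocity K x))"
        using has_derivative_linear[OF L] by (auto simp: fun_eq_iff linear_scale)
      ultimately show ?thesis unfolding has_vector_derivative_def by simp
    qed
    ultimately show ?thesis using vector_derivative_unique_at by metis
  qed
  have "(\<phi>' a * \<phi>' b) * Im (cnj (velocity K' (\<psi> a)) * velocity K' (\<psi> b)) =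
      Im (cnj (\<phi>' a *\<^sub>R velocity K' (\<psi> a)) * (\<phi>' b *\<^sub>R velocity K' (\<psi> b)))"
    by (simp add: algebra_simps)
  also have "\<dots> = Im (cnj (L (velocity K a)) * L (velocity K b))"
    using vel assms by metis
  also have "\<dots> = Im (cnj (L 1) * L \<i>) * Im (cnj (velocity K a) * velocity K b)"
    by (rule linear_complex_det[OF has_derivative_linear[OF L]])
  finally have "Im (cnj (velocity K' (\<psi> a)) * velocity K' (\<psi> b)) > 0 \<longleftrightarrow>
      Im (cnj (velocity K a) * velocity K b) > 0"
    using det pos[of a] pos[of b] by (metis mult_pos_pos zero_less_mult_pos)
  thus ?thesis unfolding turn_def by (simp only:)
qed

lemma
  assumes "c \<in> classical_crossings K"
  shows over_param_f: "over_param K' (f c) = \<psi> (over_param K c)"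
    and under_param_f: "under_param K' (f c) = \<psi> (under_param K c)"
    and crossing_sign_f: "crossing_sign K' (f c) = crossing_sign K c"
proof -
  obtain x y where xy: "x \<in> {0..<1}" "y \<in> {0..<1}" "x \<noteq> y" "curve K x = c" "curve K y = c"
    "x \<in> overs K" "y \<notin> overs K" "over_param K c = x" "under_param K c = y" "passages K {c} = {x, y}"
    by (rule classical_crossing_params[OF tw assms])
  have c': "f c \<in> classical_crossings K'"
    using assms by (simp add: classical_crossings_image)
  show 1: "over_param K' (f c) = \<psi> (over_param K c)"
    unfolding xy(8) using overs_iff[OF xy(1)] xy(4,6)
    by (intro over_param_eqI[OF tw' \<psi>_unit _ c']) (simp_all add: curve_\<psi>)
  show 2: "under_param K' (f c) = \<psi> (under_param K c)"
    unfolding xy(9) using overs_iff[OF xy(2)] xy(5,7)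
    by (intro under_param_eqI[OF tw' \<psi>_unit _ c']) (simp_all add: curve_\<psi>)
  show "crossing_sign K' (f c) = crossing_sign K c"
    unfolding crossing_sign_def 1 2 by (rule turn_\<psi>) (simp add: xy)
qed

lemma component_f:
  assumes "c \<in> classical_crossings K"
  shows "component K' (f c) l = \<psi> ` component K c l"
  by (simp add: component_def over_param_f[OF assms] under_param_f[OF assms] open_arc_image)

text \<open>Over passages go to over passages and signs are kept, so the sums agree term by term and
  not merely modulo 2. The set \<open>Z\<close> is left free to cover both the affine index and,
  once the zero crossings are known to correspond, the zero affine index.\<close>

lemma index_sum_f:
  assumes c: "c \<in> classical_crossings K" and Z: "Z \<subseteq> classical_crossings K"
  shows "(\<Sum>x | x \<in> component K' (f c) l \<and> curve K' x \<in> f ` Z.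
      (-1) ^ eps K' x * crossing_sign K' (curve K' x)) =
    (\<Sum>x | x \<in> component K c l \<and> curve K x \<in> Z. (-1) ^ eps K x * crossing_sign K (curve K x))"
proof -
  let ?S = "{x. x \<in> component K c l \<and> curve K x \<in> Z}"
  have S: "?S \<subseteq> {0..<1}" using component_subset[of K c l] by auto
  have "{x. x \<in> component K' (f c) l \<and> curve K' x \<in> f ` Z} = \<psi> ` ?S"
    unfolding component_f[OF c] by (auto simp: curve_\<psi> f_eq_iff)
  moreover have "inj_on \<psi> ?S" using inj_on_\<psi> S by (rule inj_on_subset)
  moreover have "(-1) ^ eps K' (\<psi> x) * crossing_sign K' (curve K' (\<psi> x)) =
      (-1) ^ eps K x * crossing_sign K (curve K x)" if "x \<in> ?S" for x
  proof -
    have "eps K' (\<psi> x) = eps K x"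
      using overs_iff[of x] S that by (auto simp: eps_def)
    moreover have "curve K x \<in> classical_crossings K" using that Z by auto
    ultimately show ?thesis by (simp add: curve_\<psi> crossing_sign_f)
  qed
  ultimately show ?thesis by (simp add: sum.reindex)
qed

lemma zero_crossings_image: "zero_crossings K' = f ` zero_crossings K"
proof -
  have "affine_index K' (f c) l = affine_index K c l" if "c \<in> classical_crossings K" for c l
    unfolding affine_index_def classical_crossings_image by (rule index_sum_f[OF that order_refl])
  thus ?thesis
    unfolding zero_crossings_def classical_crossings_image by auto
qed

lemma crossing_term_f:
  assumes c: "c \<in> classical_crossings K"
  shows "crossing_term K' (f c) = crossing_term K c"
proof -
  have "zero_affine_index K' (f c) 0 = zero_affine_index K c 0"
    unfolding zero_affine_index_def zero_crossings_image
    by (rule index_sum_f[OF c zero_crossings_subset])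
  hence "z_parity K' (f c) = z_parity K c" by (simp add: z_parity_def)
  moreover have "f c \<in> zero_crossings K' \<longleftrightarrow> c \<in> zero_crossings K"
    unfolding zero_crossings_image by (auto simp: f_eq_iff)
  ultimately have "s_exponent K' (f c) = s_exponent K c" by (simp add: s_exponent_def)
  moreover have "bar_parity K' (f c) l = bar_parity K c l" for l
  proof -
    have sub: "bars K \<subseteq> {0..<1}" using bars_facts(2)[OF tw] .
    have "bars K' \<inter> component K' (f c) l = \<psi> ` (bars K \<inter> component K c l)"
      unfolding component_f[OF c] bars_eq \<psi>_def[symmetric]
      using inj_on_image_Int[OF inj_on_\<psi> sub component_subset] by simp
    moreover have "inj_on \<psi> (bars K \<inter> component K c l)"
      using inj_on_\<psi> sub by (blast intro: inj_on_subset)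
    ultimately show ?thesis by (simp add: bar_parity_def card_image)
  qed
  ultimately show ?thesis by (simp add: crossing_term_def crossing_sign_f[OF c])
qed

lemma Qz_eq: "Qz K' = Qz K"
proof -
  have "inj_on f (classical_crossings K)"
    using bij_f by (meson bij_is_inj inj_on_subset subset_UNIV)
  thus ?thesis
    unfolding Qz_eq_sum[OF tw] Qz_eq_sum[OF tw'] classical_crossings_image
    by (simp add: sum.reindex crossing_term_f)
qed

end

lemma planar_isotopic_Qz:
  assumes "twisted_knot_diagram K" "twisted_knot_diagram K'" "planar_isotopic K K'"
  shows "Qz K = Qz K'"
proof -
  obtain H \<phi> where "isotopy K K' H \<phi>"
    using assms unfolding planar_isotopic_def isotopy_def by blast
  from isotopy.Qz_eq[OF this] show ?thesis by simp
qed

theorem theorem3p14: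
  fixes K K' :: diagram and m :: move_type
  assumes "twisted_knot_diagram K" and "twisted_knot_diagram K'"
    and "reidemeister_move m K K'"
  shows "Qz K = Qz K'"
proof -
  obtain L L' where L: "twisted_knot_diagram L" "twisted_knot_diagram L'" "planar_isotopic K L"
    "local_move m L L' \<or> local_move m L' L" "planar_isotopic L' K'"
    using assms(3) unfolding reidemeister_move_def by blast
  have "Qz K = Qz L" by (rule planar_isotopic_Qz[OF assms(1) L(1,3)])
  also have "\<dots> = Qz L'" using L(4) local_move_Qz by metis
  also have "\<dots> = Qz K'" by (rule planar_isotopic_Qz[OF L(2) assms(2) L(5)])
  finally show ?thesis .
qed

end
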